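(* Let $D\subset\mathbb{R}^d$ be a domain, and fix a closed ball $\bar B_o(r)=\{x\in\mathbb{R}^d: |x-o|\le r\}\subset D$ with $o\in D$, $r>0$. Let $H\subset \operatorname{sbh}(D)$ be a convex cone (closed under sums and under multiplication by nonnegative reals) that contains the constant functions $0$ and $-1$, and suppose that for every sequence $(h_k)_{k\in\mathbb{N}}$ of functions $h_k\in H$ which is locally uniformly bounded above on $D$, the upper semicontinuous regularization of the pointwise upper limit $\limsup_{k\to\infty}h_k$ belongs to $H$. Let $g\in C(D)$ and $h_1,h_2\in H$ with $h_1,h_2\not\equiv-\infty$, put $s:=g+h_1-h_2$, and let $f$ be any function defined $\mathfrak m_d$-almost everywhere on $D$ with $f=s$ $\mathfrak m_d$-a.e. Then $$ \sup\Bigl\{\int_{\bar B_o(r)} h\,d\mathfrak m_d \;\Bigm|\; h\in H,\ h\not\equiv-\infty,\ h\le f\ \mathfrak m_d\text{-a.e. on } D\Bigr\} =\inf_{\mu\in J_H}\int_D s\,d\mu , $$ where $$ J_H:=\Bigl\{\mu\in \mathrm{Meas}_0^+(D)\;\Bigm|\; \int_{\bar B_o(r)} h\,d\mathfrak m_d\le \int_D h\,d\mu\ \text{ for all } h\in H\Bigr\}, $$ and $\int_D s\,d\mu:=\int_D g\,d\mu+\int_D h_1\,d\mu-\int_D h_2\,d\mu$ (all three integrals are finite for $\mu\in J_H$). Both sides take values in $[-\infty,+\infty]$, with the conventions $\sup\emptyset=-\infty$, $\inf\emptyset=+\infty$. In particular, there exists $h\in H$, $h\not\equiv-\infty$, with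 $h\le f$ $\mathfrak m_d$-a.e. on $D$ if and only if $\inf_{\mu\in J_H}\int_D s\,d\mu\neq-\infty$.
   Context: $\mathfrak m_d$ denotes Lebesgue measure on $\mathbb{R}^d$; "a.e." always refers to $\mathfrak m_d$. $C(D)$ is the space of real-valued continuous functions on $D$. $\operatorname{sbh}(D)$ is the convex cone of all subharmonic functions on $D$, including the function identically equal to $-\infty$. A constant $c$ is regarded as the function identically equal to $c$. $\mathrm{Meas}_0^+(D)$ is the class of all positive finite Borel measures on $D$ with compact support contained in $D$. *)

theory Defs
  imports "HOL-Analysis.Analysis"
begin

text \<open>Functions on a domain D are represented as total functions of type 'a => ereal;
  only their values on D matter.  Integral of an extended-real function over a set A
  w.r.t. a measure M: positive part minus negative part.\<close>

definition eint :: "'a measure \<Rightarrow> 'a set \<Rightarrow> ('a \<Rightarrow> ereal) \<Rightarrow> ereal" where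
  "eint M A u =
     enn2ereal (\<integral>\<^sup>+ x. e2ennreal (max 0 (u x)) * indicator A x \<partial>M)
   - enn2ereal (\<integral>\<^sup>+ x. e2ennreal (max 0 (- u x)) * indicator A x \<partial>M)"

definition usc_on :: "'a::metric_space set \<Rightarrow> ('a \<Rightarrow> ereal) \<Rightarrow> bool" where
  "usc_on D u \<longleftrightarrow> (\<forall>x\<in>D. \<forall>c::real. u x < ereal c \<longrightarrow>
      (\<exists>e>0. \<forall>y\<in>ball x e \<inter> D. u y < ereal c))"

text \<open>Subharmonic functions on D (the function identically -infinity included):
  upper semicontinuous, never +infinity, and satisfying the sub-mean-value inequality
  over every closed ball contained in D (volume means).\<close>
definition sbh :: "'a::euclidean_space set \<Rightarrow> ('a \<Rightarrow> ereal) \<Rightarrow> bool" where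
  "sbh D u \<longleftrightarrow> (\<forall>x\<in>D. u x < \<infinity>) \<and> usc_on D u \<and>
     (\<forall>x r. 0 < r \<longrightarrow> cball x r \<subseteq> D \<longrightarrow>
        ereal (measure lebesgue (cball x r)) * u x \<le> eint lebesgue (cball x r) u)"

definition memD :: "'a set \<Rightarrow> ('a \<Rightarrow> ereal) \<Rightarrow> ('a \<Rightarrow> ereal) set \<Rightarrow> bool" where
  "memD D u H \<longleftrightarrow> (\<exists>h\<in>H. \<forall>x\<in>D. h x = u x)"

definition usc_reg :: "'a::metric_space set \<Rightarrow> ('a \<Rightarrow> ereal) \<Rightarrow> 'a \<Rightarrow> ereal" where
  "usc_reg D u x = (INF e\<in>{0<..}. SUP y\<in>ball x e \<inter> D. u y)"

definition loc_unif_bdd_above :: "'a::metric_space set \<Rightarrow> (nat \<Rightarrow> 'a \<Rightarrow> ereal) \<Rightarrow> bool" where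
  "loc_unif_bdd_above D hs \<longleftrightarrow>
     (\<forall>x\<in>D. \<exists>e>0. \<exists>C::real. \<forall>k. \<forall>y\<in>ball x e \<inter> D. hs k y \<le> ereal C)"

definition msupp :: "'a::metric_space measure \<Rightarrow> 'a set" where
  "msupp \<mu> = {x. \<forall>e>0. emeasure \<mu> (ball x e) \<noteq> 0}"

definition Meas0plus :: "'a::metric_space set \<Rightarrow> 'a measure \<Rightarrow> bool" where
  "Meas0plus D \<mu> \<longleftrightarrow> sets \<mu> = sets borel \<and> emeasure \<mu> (space \<mu>) < \<infinity>
     \<and> compact (msupp \<mu>) \<and> msupp \<mu> \<subseteq> D"

definition JH :: "'a::euclidean_space set \<Rightarrow> ('a \<Rightarrow> ereal) set \<Rightarrow> 'a \<Rightarrow> real \<Rightarrow> 'a measure set" where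
  "JH D H x0 r = {\<mu>. Meas0plus D \<mu> \<and>
      (\<forall>h\<in>H. eint lebesgue (cball x0 r) h \<le> eint \<mu> D h)}"

end

theory Submission
  imports Defs
begin

text \<open>The inequality from left to right: \<open>h + h\<^sub>2 \<le> g + h\<^sub>1\<close> a.e. implies the same everywhere
  (sub-mean value property against upper semicontinuity) and can be integrated against any
  \<open>\<mu>\<close> in \<open>J\<^sub>H\<close>.

  For the converse, no Hahn--Banach or Riesz theorem is needed. Fix a compact \<open>K\<close> and put
  \<open>q = h\<^sub>2 - max (g + h\<^sub>1) (-m)\<close>. Consider the penalized functional
  \<open>F h = \<integral>\<^sub>B h - N \<integral>\<^sub>K ((h + q)\<^sup>+)\<^sup>2\<close> on the cone. By the parallelogram law, \<open>(h + q)\<^sup>+\<close> is Cauchy along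
  a maximizing sequence. The first variation in the directions of the cone shows that
  \<open>2 N lim (h + q)\<^sup>+\<close> is the density of a measure \<open>\<mu>\<close> in \<open>J\<^sub>H\<close>; the variation \<open>(1 - t) h\<close> shows that
  \<open>sup F \<ge> - \<integral> q d\<mu>\<close>, which is at least the infimum on the right-hand side. For large \<open>N\<close> this gives
  \<open>h\<close> in the cone with \<open>\<integral>\<^sub>B h\<close> almost as large as the infimum and \<open>\<integral>\<^sub>K (h + q)\<^sup>+\<close> small. Exhausting \<open>D\<close> by
  compacts, the regularized upper limit of such functions is the required minorant.\<close>

section \<open>Penalized maximization over a cone\<close>

text \<open>The square is chosen for its uniform convexity: it makes the excess converge along a
  maximizing sequence, where a penalty linear in the excess would only keep the functional bounded.
  The sequence itself may fail to converge; this is harmless, since the first variation sees the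
  penalty only through the excess.

  The cut-off at \<open>-m\<close> answers another obstacle. Where \<open>h\<^sub>1\<close> tends to
  minus infinity, \<open>h\<^sub>2 - (g + h\<^sub>1)\<close> is unbounded above and its positive
  part need not be square integrable. After the cut-off, \<open>q\<close> is bounded above on
  \<open>K\<close>, because \<open>h\<^sub>2\<close> is. Since \<open>- q\<close> lies above
  \<open>s\<close>, its integrals against dual measures still dominate those of \<open>s\<close>;
  the cut-off disappears when \<open>m\<close> grows together with \<open>K\<close>.

  The penalty is confined to \<open>K\<close> so that the measure it produces is finite with compact
  support in \<open>D\<close>. The price is that pointwise upper bounds have to be regained from
  integral estimates by the sub-mean value inequality.\<close>

lemma truncation_limit:
  fixes \<rho> v :: "'a \<Rightarrow> real"
  assumes \<rho>: "integrable M \<rho>" "\<And>x. 0 \<le> \<rho> x"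
    and v: "v \<in> borel_measurable M" "AE x in M. v x \<le> C"
    and le: "\<And>m::nat. a \<le> (\<integral>x. \<rho> x * max (v x) (- real m) \<partial>M)"
  shows "integrable M (\<lambda>x. \<rho> x * v x) \<and> a \<le> (\<integral>x. \<rho> x * v x \<partial>M)"
proof -
  note [measurable] = v(1) borel_measurable_integrable[OF \<rho>(1)]
  define w where "w = (\<lambda>(m::nat) x. \<rho> x * max (v x) (- real m))"
  have iw: "integrable M (w m)" for m
  proof (rule Bochner_Integration.integrable_bound[where f = "\<lambda>x. (\<bar>C\<bar> + real m) * \<rho> x"])
    show "integrable M (\<lambda>x. (\<bar>C\<bar> + real m) * \<rho> x)" using \<rho>(1) by simp
    show "w m \<in> borel_measurable M" unfolding w_def by measurable
    show "AE x in M. norm (w m x) \<le> norm ((\<bar>C\<bar> + real m) * \<rho> x)"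
      using v(2)
    proof eventually_elim
      case (elim x)
      then have "\<bar>max (v x) (- real m)\<bar> \<le> \<bar>C\<bar> + real m" by linarith
      then have "\<rho> x * \<bar>max (v x) (- real m)\<bar> \<le> \<rho> x * (\<bar>C\<bar> + real m)"
        using \<rho>(2) by (intro mult_left_mono) auto
      then show ?case using \<rho>(2)[of x] by (simp add: w_def abs_mult mult.commute)
    qed
  qed
  have dec: "w (Suc m) x \<le> w m x" for m x
    unfolding w_def using \<rho>(2) by (intro mult_left_mono) auto
  have lim: "(\<lambda>m. w m x) \<longlonglongrightarrow> \<rho> x * v x" for x
  proof (rule tendsto_eventually)
    obtain k :: nat where "- v x \<le> real k" using real_arch_simple by blast
    then have "\<forall>m\<ge>k. max (v x) (- real m) = v x" by (auto simp: max_def)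
    then show "\<forall>\<^sub>F m in sequentially. w m x = \<rho> x * v x"
      by (auto simp: w_def eventually_sequentially)
  qed
  have decI: "decseq (\<lambda>m. integral\<^sup>L M (w m))"
    by (intro decseq_SucI integral_mono iw dec)
  \<comment> \<open>The common lower bound \<open>a\<close> keeps the decreasing integrals from
    tending to minus infinity; this is where integrability of the limit comes from.\<close>
  have "\<exists>l. (\<lambda>m. integral\<^sup>L M (w m)) \<longlonglongrightarrow> l \<and> (\<forall>m. l \<le> integral\<^sup>L M (w m))"
    using decseq_convergent[OF decI, of a] le unfolding w_def by metis
  then obtain l where l: "(\<lambda>m. integral\<^sup>L M (w m)) \<longlonglongrightarrow> l" by blast
  have al: "a \<le> l" using le by (intro LIMSEQ_le_const[OF l]) (auto simp: w_def)
  have "has_bochner_integral M (\<lambda>x. - (\<rho> x * v x)) (- l)"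
  proof (rule has_bochner_integral_monotone_convergence[where f = "\<lambda>m x. - w m x"])
    show "AE x in M. mono (\<lambda>n. - w n x)"
      using dec by (auto intro!: AE_I2 simp: incseq_Suc_iff)
    show "AE x in M. (\<lambda>i. - w i x) \<longlonglongrightarrow> - (\<rho> x * v x)"
      using lim by (auto intro!: AE_I2 tendsto_minus)
  qed (use iw l in \<open>auto intro: tendsto_minus\<close>)
  then have "has_bochner_integral M (\<lambda>x. \<rho> x * v x) l"
    using has_bochner_integral_minus by fastforce
  then show ?thesis using al by (simp add: has_bochner_integral_iff)
qed

text \<open>Summable L1 distances make the telescoping series converge absolutely, both a.e. and in
  L1. Convergence is recorded against bounded test functions, the form in which the first variations
  use it.\<close>

lemma L1_fast_Cauchy_limit:
  fixes f :: "nat \<Rightarrow> 'a \<Rightarrow> real"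
  assumes int: "\<And>k. integrable M (f k)" and nonneg: "\<And>k x. 0 \<le> f k x"
    and dist: "\<And>k. (\<integral>x. \<bar>f (Suc k) x - f k x\<bar> \<partial>M) \<le> C * (1/2) ^ k"
  obtains \<rho> where "integrable M \<rho>" "\<And>x. 0 \<le> \<rho> x"
    "\<And>b K. b \<in> borel_measurable M \<Longrightarrow> AE x in M. \<bar>b x\<bar> \<le> K \<Longrightarrow>
       (\<lambda>k. \<integral>x. f k x * b x \<partial>M) \<longlonglongrightarrow> (\<integral>x. \<rho> x * b x \<partial>M)"
proof -
  define d where "d = (\<lambda>k x. f (Suc k) x - f k x)"
  have id: "integrable M (d k)" for k unfolding d_def using int by simp
  note [measurable] = borel_measurable_integrable[OF id] borel_measurable_integrable[OF int]
  have sI: "summable (\<lambda>k. \<integral>x. \<bar>d k x\<bar> \<partial>M)"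
  proof (rule summable_comparison_test')
    show "summable (\<lambda>k. C * (1/2) ^ k :: real)" by (intro summable_mult summable_geometric) simp
    show "norm (\<integral>x. \<bar>d k x\<bar> \<partial>M) \<le> C * (1/2) ^ k" for k
      using dist[of k] by (simp add: d_def)
  qed
  have "(\<integral>\<^sup>+x. (\<Sum>k. ennreal \<bar>d k x\<bar>) \<partial>M) = (\<Sum>k. \<integral>\<^sup>+x. ennreal \<bar>d k x\<bar> \<partial>M)"
    by (intro nn_integral_suminf) measurable
  also have "\<dots> = (\<Sum>k. ennreal (\<integral>x. \<bar>d k x\<bar> \<partial>M))"
    using id by (intro suminf_cong nn_integral_eq_integral) auto
  also have "\<dots> \<noteq> top" using sI by (intro ennreal_suminf_neq_top) auto
  finally have "AE x in M. (\<Sum>k. ennreal \<bar>d k x\<bar>) \<noteq> \<infinity>"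
    by (intro nn_integral_noteq_infinite) (auto)
  then have sA: "AE x in M. summable (\<lambda>k. \<bar>d k x\<bar>)"
    by eventually_elim (auto intro!: summable_suminf_not_top)
  \<comment> \<open>Nonnegativity of the sum is known only where the series converges; the maximum
    with 0 provides it at every point.\<close>
  define \<rho> where "\<rho> = (\<lambda>x. max 0 (f 0 x + (\<Sum>k. d k x)))"
  have telescope: "(\<Sum>k<n. d k x) = f n x - f 0 x" for n x
    unfolding d_def by (rule sum_lessThan_telescope)
  have \<rho>_eq: "AE x in M. \<rho> x = f 0 x + (\<Sum>k. d k x)"
    using sA
  proof eventually_elim
    case (elim x)
    then have "(\<lambda>k. d k x) sums (\<Sum>k. d k x)"
      by (rule summable_sums[OF summable_rabs_cancel])
    then have "(\<lambda>n. f n x - f 0 x) \<longlonglongrightarrow> (\<Sum>k. d k x)"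
      unfolding sums_def telescope .
    then have "- f 0 x \<le> (\<Sum>k. d k x)"
      by (rule LIMSEQ_le_const) (use nonneg in auto)
    then show ?case by (simp add: \<rho>_def)
  qed
  have isum: "integrable M (\<lambda>x. \<Sum>k. d k x)"
    using id sA sI by (intro integrable_suminf) auto
  have i\<rho>: "integrable M \<rho>" unfolding \<rho>_def using isum int[of 0] by simp
  show ?thesis
  proof (rule that[of \<rho>])
    show "integrable M \<rho>" by fact
    show "0 \<le> \<rho> x" for x by (simp add: \<rho>_def)
  next
    fix b :: "'a \<Rightarrow> real" and K assume [measurable]: "b \<in> borel_measurable M"
      and bK: "AE x in M. \<bar>b x\<bar> \<le> K"
    have ib: "integrable M (\<lambda>x. v x * b x)" if "integrable M v" for v :: "'a \<Rightarrow> real"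
    proof (rule Bochner_Integration.integrable_bound)
      show "integrable M (\<lambda>x. K * v x)" using that by simp
      show "(\<lambda>x. v x * b x) \<in> borel_measurable M"
        using borel_measurable_integrable[OF that] by measurable
      show "AE x in M. norm (v x * b x) \<le> norm (K * v x)"
        using bK
      proof eventually_elim
        case (elim x)
        then have "\<bar>v x\<bar> * \<bar>b x\<bar> \<le> \<bar>v x\<bar> * \<bar>K\<bar>" by (intro mult_left_mono) auto
        then show ?case by (simp add: abs_mult mult.commute)
      qed
    qed
    have bound: "AE x in M. \<bar>d k x * b x\<bar> \<le> K * \<bar>d k x\<bar>" for k
      using bK
    proof eventually_elim
      case (elim x)
      then have "\<bar>d k x\<bar> * \<bar>b x\<bar> \<le> \<bar>d k x\<bar> * K" by (intro mult_left_mono) auto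
      then show ?case by (simp add: abs_mult mult.commute)
    qed
    have "(\<lambda>k. \<integral>x. d k x * b x \<partial>M) sums (\<integral>x. (\<Sum>k. d k x * b x) \<partial>M)"
    proof (rule sums_integral)
      show "integrable M (\<lambda>x. d k x * b x)" for k by (rule ib[OF id])
      show "AE x in M. summable (\<lambda>i. norm (d i x * b x))"
        using sA by eventually_elim (simp add: abs_mult summable_mult2)
      show "summable (\<lambda>i. \<integral>x. norm (d i x * b x) \<partial>M)"
      proof (rule summable_comparison_test')
        show "summable (\<lambda>k. K * (\<integral>x. \<bar>d k x\<bar> \<partial>M))" using sI by (rule summable_mult)
        have "(\<integral>x. norm (d k x * b x) \<partial>M) \<le> (\<integral>x. K * \<bar>d k x\<bar> \<partial>M)" for k
          using bound[of k] ib[OF id[of k]] id[of k] by (intro integral_mono_AE) auto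
        then show "norm (\<integral>x. norm (d k x * b x) \<partial>M) \<le> K * (\<integral>x. \<bar>d k x\<bar> \<partial>M)" for k
          by simp
      qed
    qed
    then have "(\<lambda>n. \<Sum>k<n. \<integral>x. d k x * b x \<partial>M) \<longlonglongrightarrow> (\<integral>x. (\<Sum>k. d k x * b x) \<partial>M)"
      by (simp add: sums_def)
    moreover have "(\<Sum>k<n. \<integral>x. d k x * b x \<partial>M)
        = (\<integral>x. f n x * b x \<partial>M) - (\<integral>x. f 0 x * b x \<partial>M)" for n
    proof -
      have "(\<integral>x. d k x * b x \<partial>M) = (\<integral>x. f (Suc k) x * b x \<partial>M) - (\<integral>x. f k x * b x \<partial>M)" for k
        using ib[OF int] by (simp add: d_def left_diff_distrib)
      then show ?thesis
        using sum_lessThan_telescope[of "\<lambda>k. \<integral>x. f k x * b x \<partial>M" n] by simp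
    qed
    ultimately have "(\<lambda>n. (\<integral>x. f n x * b x \<partial>M) - (\<integral>x. f 0 x * b x \<partial>M) + (\<integral>x. f 0 x * b x \<partial>M))
        \<longlonglongrightarrow> (\<integral>x. (\<Sum>k. d k x * b x) \<partial>M) + (\<integral>x. f 0 x * b x \<partial>M)"
      by (intro tendsto_add tendsto_const) simp
    moreover have "(\<integral>x. \<rho> x * b x \<partial>M) = (\<integral>x. (\<Sum>k. d k x) * b x + f 0 x * b x \<partial>M)"
    proof (rule integral_cong_AE)
      show "AE x in M. \<rho> x * b x = (\<Sum>k. d k x) * b x + f 0 x * b x"
        using \<rho>_eq by eventually_elim (simp add: algebra_simps)
    qed (use ib[OF i\<rho>] ib[OF isum] ib[OF int[of 0]] in simp_all)
    moreover have "\<dots> = (\<integral>x. (\<Sum>k. d k x) * b x \<partial>M) + (\<integral>x. f 0 x * b x \<partial>M)"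
      using ib[OF isum] ib[OF int[of 0]] by simp
    moreover have "(\<integral>x. (\<Sum>k. d k x) * b x \<partial>M) = (\<integral>x. (\<Sum>k. d k x * b x) \<partial>M)"
    proof (rule integral_cong_AE)
      show "AE x in M. (\<Sum>k. d k x) * b x = (\<Sum>k. d k x * b x)"
        using sA by eventually_elim (rule suminf_mult2[OF summable_rabs_cancel])
    qed (use ib[OF isum] in simp, measurable)
    ultimately show "(\<lambda>k. \<integral>x. f k x * b x \<partial>M) \<longlonglongrightarrow> (\<integral>x. \<rho> x * b x \<partial>M)" by simp
  qed
qed

section \<open>The penalized functional and its first variations\<close>

locale penalized_cone = finite_measure M for M :: "'a measure" +
  fixes Hs :: "('a \<Rightarrow> real) set" and B :: "'a set" and q :: "'a \<Rightarrow> real"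
  assumes B_sets [measurable]: "B \<in> sets M"
    and Hs_int: "u \<in> Hs \<Longrightarrow> integrable M u"
    and Hs_bdd: "u \<in> Hs \<Longrightarrow> \<exists>C. AE x in M. u x \<le> C"
    and Hs_cone: "u \<in> Hs \<Longrightarrow> v \<in> Hs \<Longrightarrow> 0 \<le> a \<Longrightarrow> 0 \<le> b \<Longrightarrow>
          \<exists>w\<in>Hs. AE x in M. w x = a * u x + b * v x"
    and Hs_ne: "Hs \<noteq> {}"
    and q_int: "integrable M q"
    and q_bdd: "\<exists>C. AE x in M. q x \<le> C"
begin

definition excess :: "('a \<Rightarrow> real) \<Rightarrow> 'a \<Rightarrow> real" where
  "excess u x = max 0 (u x + q x)"

definition mass :: "('a \<Rightarrow> real) \<Rightarrow> real" where
  "mass u = (\<integral>x. indicator B x * u x \<partial>M)"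

definition pen :: "real \<Rightarrow> ('a \<Rightarrow> real) \<Rightarrow> real" where
  "pen N u = mass u - N * (\<integral>x. (excess u x)\<^sup>2 \<partial>M)"

lemma q_meas [measurable]: "q \<in> borel_measurable M"
  using q_int by simp

lemma excess_nonneg: "0 \<le> excess u x"
  by (simp add: excess_def)

lemma excess_meas: "u \<in> Hs \<Longrightarrow> excess u \<in> borel_measurable M"
  unfolding excess_def using borel_measurable_integrable[OF Hs_int] by measurable

lemma integrable_bounded_sq:
  fixes b :: "'a \<Rightarrow> real"
  assumes "b \<in> borel_measurable M" "AE x in M. \<bar>b x\<bar> \<le> C"
  shows "integrable M (\<lambda>x. (b x)\<^sup>2)"
proof (rule integrable_const_bound[where B = "C\<^sup>2"])
  show "AE x in M. norm ((b x)\<^sup>2) \<le> C\<^sup>2"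
    using assms(2)
  proof eventually_elim
    case (elim x)
    then have "\<bar>b x\<bar>\<^sup>2 \<le> C\<^sup>2" by (intro power_mono) auto
    then show ?case by simp
  qed
qed (use assms in measurable)

lemma excess_bdd:
  assumes "u \<in> Hs" obtains C where "AE x in M. excess u x \<le> C"
proof -
  obtain C1 where 1: "AE x in M. u x \<le> C1" using Hs_bdd[OF assms] by blast
  obtain C2 where 2: "AE x in M. q x \<le> C2" using q_bdd by blast
  have "AE x in M. excess u x \<le> max 0 (C1 + C2)"
    using 1 2 by eventually_elim (auto simp: excess_def)
  then show ?thesis using that by blast
qed

lemma integrable_excess_mult:
  assumes u: "u \<in> Hs" and b: "b \<in> borel_measurable M" "AE x in M. \<bar>b x\<bar> \<le> C"
  shows "integrable M (\<lambda>x. excess u x * b x)"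
proof -
  note [measurable] = excess_meas[OF u] b(1)
  obtain C1 where 1: "AE x in M. excess u x \<le> C1" using excess_bdd[OF u] .
  show ?thesis
  proof (rule integrable_const_bound[where B = "\<bar>C1\<bar> * \<bar>C\<bar>"])
    show "AE x in M. norm (excess u x * b x) \<le> \<bar>C1\<bar> * \<bar>C\<bar>"
      using 1 b(2)
    proof eventually_elim
      case (elim x)
      then have "\<bar>excess u x\<bar> \<le> \<bar>C1\<bar>" "\<bar>b x\<bar> \<le> \<bar>C\<bar>" using excess_nonneg[of u x] by auto
      then show ?case by (auto simp: abs_mult intro!: mult_mono)
    qed
  qed measurable
qed

lemma integrable_excess: "u \<in> Hs \<Longrightarrow> integrable M (excess u)"
  using integrable_excess_mult[of u "\<lambda>_. 1" 1] by simp

lemma integrable_excess_excess: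
  assumes "u \<in> Hs" "v \<in> Hs" shows "integrable M (\<lambda>x. excess u x * excess v x)"
proof -
  obtain C where "AE x in M. excess v x \<le> C" using excess_bdd[OF assms(2)] .
  then have "AE x in M. \<bar>excess v x\<bar> \<le> C" using excess_nonneg by simp
  then show ?thesis using assms excess_meas by (intro integrable_excess_mult) auto
qed

lemma integrable_excess_sq: "u \<in> Hs \<Longrightarrow> integrable M (\<lambda>x. (excess u x)\<^sup>2)"
  using integrable_excess_excess[of u u] by (simp add: power2_eq_square)

lemma integrable_mass: "integrable M (u :: 'a \<Rightarrow> real) \<Longrightarrow> integrable M (\<lambda>x. indicator B x * u x)"
  using integrable_real_mult_indicator[OF B_sets, of u] by (simp add: mult.commute)

lemma mass_combo:
  assumes "u \<in> Hs" "v \<in> Hs" "w \<in> Hs" "AE x in M. w x = a * u x + b * v x"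
  shows "mass w = a * mass u + b * mass v"
proof -
  note i = integrable_mass[OF Hs_int[OF assms(1)]] integrable_mass[OF Hs_int[OF assms(2)]]
  have "mass w = (\<integral>x. a * (indicator B x * u x) + b * (indicator B x * v x) \<partial>M)"
    unfolding mass_def
  proof (rule integral_cong_AE)
    show "AE x in M. indicator B x * w x
        = a * (indicator B x * u x) + b * (indicator B x * v x)"
      using assms(4) by eventually_elim (simp add: algebra_simps)
  qed (use i integrable_mass[OF Hs_int[OF assms(3)]] in auto)
  also have "\<dots> = a * mass u + b * mass v"
    unfolding mass_def using i by simp
  finally show ?thesis .
qed

lemma mass_le:
  assumes "u \<in> Hs" shows "mass u \<le> - mass q + (\<integral>x. excess u x \<partial>M)"
proof -
  note i = integrable_mass[OF Hs_int[OF assms]] integrable_mass[OF q_int] integrable_excess[OF assms]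
  have "(\<integral>x. indicator B x * u x + indicator B x * q x \<partial>M) \<le> (\<integral>x. excess u x \<partial>M)"
  proof (rule integral_mono)
    show "indicator B x * u x + indicator B x * q x \<le> excess u x" for x
      by (auto simp: excess_def indicator_def)
  qed (use i in auto)
  then show ?thesis using i by (simp add: mass_def)
qed

text \<open>Completing the square. The free parameter trades the excess for its square: it bounds
  \<open>pen\<close> from above, turns L2 estimates into L1 estimates, and finally makes the
  integral of the excess small.\<close>

lemma linear_le_square: "0 < N \<Longrightarrow> t \<le> N * t\<^sup>2 + 1 / (4 * N)" for t N :: real
proof -
  assume "0 < N"
  have "0 \<le> (2 * N * t - 1)\<^sup>2 / (4 * N)" using \<open>0 < N\<close> by simp
  also have "\<dots> = N * t\<^sup>2 + 1 / (4 * N) - t"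
    using \<open>0 < N\<close> by (simp add: power2_eq_square field_simps)
  finally show ?thesis by simp
qed

lemma integral_excess_le:
  assumes "u \<in> Hs" "0 < N"
  shows "(\<integral>x. excess u x \<partial>M) \<le> N * (\<integral>x. (excess u x)\<^sup>2 \<partial>M) + measure M (space M) / (4 * N)"
proof -
  have "(\<integral>x. excess u x \<partial>M) \<le> (\<integral>x. N * (excess u x)\<^sup>2 + 1 / (4 * N) \<partial>M)"
    using assms integrable_excess[OF assms(1)] integrable_excess_sq[OF assms(1)]
    by (intro integral_mono linear_le_square) auto
  then show ?thesis
    using integrable_excess_sq[OF assms(1)] by (simp add: mult.commute)
qed

lemma pen_le:
  assumes "u \<in> Hs" "0 < N" shows "pen N u \<le> - mass q + measure M (space M) / (4 * N)"
  using mass_le[OF assms(1)] integral_excess_le[OF assms] unfolding pen_def by linarith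

text \<open>The midpoint competes with \<open>u\<close> and \<open>v\<close>: its
  \<open>mass\<close> is their average, while its squared excess integrates to less than the average
  by at least a quarter of the squared distance of the two excesses. The functions \<open>u\<close>
  and \<open>v\<close> themselves may stay far apart where both excesses vanish.\<close>

lemma near_maximizers_close:
  assumes u: "u \<in> Hs" and v: "v \<in> Hs" and N: "0 < N"
    and S: "\<And>w. w \<in> Hs \<Longrightarrow> pen N w \<le> S"
    and du: "S - d \<le> pen N u" and dv: "S - d \<le> pen N v"
  shows "(\<integral>x. (excess u x - excess v x)\<^sup>2 \<partial>M) \<le> 4 * d / N"
proof -
  obtain w where w: "w \<in> Hs" "AE x in M. w x = (1/2) * u x + (1/2) * v x"
    using Hs_cone[OF u v, of "1/2" "1/2"] by auto
  note i = integrable_excess_sq[OF u] integrable_excess_sq[OF v] integrable_excess_excess[OF u v]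
  have id: "integrable M (\<lambda>x. (excess u x - excess v x)\<^sup>2)"
    using i by (simp add: power2_diff mult.assoc)
  have "(\<integral>x. (excess w x)\<^sup>2 \<partial>M) \<le> (\<integral>x. (1/2) * (excess u x)\<^sup>2 + (1/2) * (excess v x)\<^sup>2
      - (1/4) * (excess u x - excess v x)\<^sup>2 \<partial>M)"
  proof (rule integral_mono_AE)
    show "AE x in M. (excess w x)\<^sup>2 \<le> (1/2) * (excess u x)\<^sup>2 + (1/2) * (excess v x)\<^sup>2
      - (1/4) * (excess u x - excess v x)\<^sup>2"
      using w(2)
    proof eventually_elim
      case (elim x)
      have "excess w x \<le> (excess u x + excess v x) / 2"
        using elim by (auto simp: excess_def max_def)
      then have "(excess w x)\<^sup>2 \<le> ((excess u x + excess v x) / 2)\<^sup>2"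
        using excess_nonneg by (intro power_mono)
      then show ?case by (simp add: power2_eq_square field_simps)
    qed
  qed (use i id integrable_excess_sq[OF w(1)] in auto)
  also have "\<dots> = (1/2) * (\<integral>x. (excess u x)\<^sup>2 \<partial>M) + (1/2) * (\<integral>x. (excess v x)\<^sup>2 \<partial>M)
      - (1/4) * (\<integral>x. (excess u x - excess v x)\<^sup>2 \<partial>M)"
    using i id by simp
  finally have "N * (\<integral>x. (excess w x)\<^sup>2 \<partial>M) \<le> N * ((1/2) * (\<integral>x. (excess u x)\<^sup>2 \<partial>M)
      + (1/2) * (\<integral>x. (excess v x)\<^sup>2 \<partial>M) - (1/4) * (\<integral>x. (excess u x - excess v x)\<^sup>2 \<partial>M))"
    using N by simp
  moreover have "mass w = (1/2) * mass u + (1/2) * mass v"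
    using mass_combo[OF u v w] .
  ultimately have "N * (\<integral>x. (excess u x - excess v x)\<^sup>2 \<partial>M) \<le> 4 * d"
    using S[OF w(1)] du dv unfolding pen_def by (simp add: algebra_simps)
  then show ?thesis using N by (simp add: field_simps)
qed

text \<open>The role of \<open>b\<close> is that of a truncation of \<open>v\<close> from below: \<open>v\<^sup>2\<close> need not be integrable.\<close>
lemma variation_add:
  assumes u: "u \<in> Hs" and v: "v \<in> Hs" and N: "0 < N" and t: "0 < t"
    and S: "\<And>w. w \<in> Hs \<Longrightarrow> pen N w \<le> S" and du: "S - d \<le> pen N u"
    and b: "b \<in> borel_measurable M" "AE x in M. \<bar>b x\<bar> \<le> C" "AE x in M. v x \<le> b x"
  shows "mass v \<le> d / t + 2 * N * (\<integral>x. excess u x * b x \<partial>M) + N * t * (\<integral>x. (b x)\<^sup>2 \<partial>M)"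
proof -
  note [measurable] = b(1)
  obtain w where w: "w \<in> Hs" "AE x in M. w x = 1 * u x + t * v x"
    using Hs_cone[OF u v, of 1 t] t by auto
  note b2 = integrable_bounded_sq[OF b(1,2)]
  note i = integrable_excess_sq[OF u] integrable_excess_mult[OF u b(1,2)] b2
  have "(\<integral>x. (excess w x)\<^sup>2 \<partial>M)
     \<le> (\<integral>x. (excess u x)\<^sup>2 + (2 * t) * (excess u x * b x) + t\<^sup>2 * (b x)\<^sup>2 \<partial>M)"
  proof (rule integral_mono_AE)
    show "AE x in M. (excess w x)\<^sup>2 \<le> (excess u x)\<^sup>2 + (2 * t) * (excess u x * b x) + t\<^sup>2 * (b x)\<^sup>2"
      using w(2) b(3)
    proof eventually_elim
      case (elim x)
      have "t * v x \<le> t * b x" using elim t by simp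
      \<comment> \<open>The absolute value accounts for negative \<open>b x\<close>: the sum may
        drop below 0, where \<open>excess w x\<close> is 0.\<close>
      then have "excess w x \<le> \<bar>excess u x + t * b x\<bar>"
        using elim by (auto simp: excess_def max_def)
      then have "(excess w x)\<^sup>2 \<le> (excess u x + t * b x)\<^sup>2"
        using excess_nonneg by (metis abs_le_square_iff abs_of_nonneg)
      then show ?case by (simp add: power2_eq_square algebra_simps)
    qed
  qed (use i integrable_excess_sq[OF w(1)] in auto)
  also have "\<dots> = (\<integral>x. (excess u x)\<^sup>2 \<partial>M) + (2 * t) * (\<integral>x. excess u x * b x \<partial>M)
     + t\<^sup>2 * (\<integral>x. (b x)\<^sup>2 \<partial>M)"
    using i by simp
  finally have "N * (\<integral>x. (excess w x)\<^sup>2 \<partial>M) \<le> N * \<dots>" using N by simp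
  moreover have "mass w = 1 * mass u + t * mass v" using mass_combo[OF u v w] .
  ultimately have "t * mass v \<le> d + t * (2 * N * (\<integral>x. excess u x * b x \<partial>M))
      + t * (N * t * (\<integral>x. (b x)\<^sup>2 \<partial>M))"
    using S[OF w(1)] du unfolding pen_def by (simp add: algebra_simps power2_eq_square)
  also have "\<dots> = t * (d / t + 2 * N * (\<integral>x. excess u x * b x \<partial>M) + N * t * (\<integral>x. (b x)\<^sup>2 \<partial>M))"
    using t by (simp add: field_simps)
  finally show ?thesis using t by (simp only: mult_le_cancel_left_pos)
qed

text \<open>Since \<open>(1 - t) * u + q\<close> is a convex combination of \<open>u + q\<close> and
  \<open>q\<close>, both \<open>mass\<close> and the squared excess keep a factor
  \<open>1 - t\<close>, up to terms in \<open>b\<close>. This compares the value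
  \<open>pen N u\<close> itself, rather than a derivative, with the excess integrated against a
  majorant of \<open>q\<close>.\<close>

lemma variation_shrink:
  assumes u: "u \<in> Hs" and N: "0 < N" and t: "0 < t" "t < 1"
    and S: "\<And>w. w \<in> Hs \<Longrightarrow> pen N w \<le> S" and du: "S - d \<le> pen N u"
    and b: "b \<in> borel_measurable M" "AE x in M. \<bar>b x\<bar> \<le> C" "AE x in M. q x \<le> b x"
  shows "- pen N u \<le> d / t + 2 * N * (1 - t) * (\<integral>x. excess u x * b x \<partial>M)
    + N * t * (\<integral>x. (b x)\<^sup>2 \<partial>M)"
proof -
  note [measurable] = b(1)
  obtain w where w: "w \<in> Hs" "AE x in M. w x = (1 - t) * u x + 0 * u x"
    using Hs_cone[OF u u, of "1 - t" 0] t by auto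
  note b2 = integrable_bounded_sq[OF b(1,2)]
  note i = integrable_excess_sq[OF u] integrable_excess_mult[OF u b(1,2)] b2
  have "(\<integral>x. (excess w x)\<^sup>2 \<partial>M)
     \<le> (\<integral>x. (1 - t) * (excess u x)\<^sup>2 + (2 * t * (1 - t)) * (excess u x * b x) + t\<^sup>2 * (b x)\<^sup>2 \<partial>M)"
  proof (rule integral_mono_AE)
    show "AE x in M. (excess w x)\<^sup>2
      \<le> (1 - t) * (excess u x)\<^sup>2 + (2 * t * (1 - t)) * (excess u x * b x) + t\<^sup>2 * (b x)\<^sup>2"
      using w(2) b(3)
    proof eventually_elim
      case (elim x)
      have "t * q x \<le> t * b x" using elim t by simp
      moreover have "(1 - t) * (u x + q x) \<le> (1 - t) * excess u x"
        using t by (intro mult_left_mono) (auto simp: excess_def)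
      ultimately have "w x + q x \<le> (1 - t) * excess u x + t * b x"
        using elim by (simp add: algebra_simps)
      then have "excess w x \<le> \<bar>(1 - t) * excess u x + t * b x\<bar>"
        by (auto simp: excess_def max_def)
      then have "(excess w x)\<^sup>2 \<le> ((1 - t) * excess u x + t * b x)\<^sup>2"
        using excess_nonneg by (metis abs_le_square_iff abs_of_nonneg)
      \<comment> \<open>Here \<open>(1 - t)\<^sup>2\<close> is split as
        \<open>(1 - t) - t * (1 - t)\<close>. Giving away the last term leaves the factor that
        \<open>mass w\<close> also carries, so that the two combine to
        \<open>(1 - t) * pen N u\<close>.\<close>
      also have "\<dots> = (1 - t) * (excess u x)\<^sup>2 + (2 * t * (1 - t)) * (excess u x * b x) + t\<^sup>2 * (b x)\<^sup>2
          - t * (1 - t) * (excess u x)\<^sup>2"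
        by (simp add: power2_eq_square algebra_simps)
      finally show ?case using t by (smt (verit) mult_nonneg_nonneg zero_le_power2)
    qed
  qed (use i integrable_excess_sq[OF w(1)] in auto)
  also have "\<dots> = (1 - t) * (\<integral>x. (excess u x)\<^sup>2 \<partial>M) + (2 * t * (1 - t)) * (\<integral>x. excess u x * b x \<partial>M)
     + t\<^sup>2 * (\<integral>x. (b x)\<^sup>2 \<partial>M)"
    using i by simp
  finally have "N * (\<integral>x. (excess w x)\<^sup>2 \<partial>M) \<le> N * \<dots>" using N by simp
  moreover have "mass w = (1 - t) * mass u + 0 * mass u" using mass_combo[OF u u w] .
  ultimately have "t * (- pen N u) \<le> d + t * (2 * N * (1 - t) * (\<integral>x. excess u x * b x \<partial>M))
      + t * (N * t * (\<integral>x. (b x)\<^sup>2 \<partial>M))"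
    using S[OF w(1)] du unfolding pen_def by (simp add: algebra_simps power2_eq_square)
  also have "\<dots> = t * (d / t + 2 * N * (1 - t) * (\<integral>x. excess u x * b x \<partial>M)
      + N * t * (\<integral>x. (b x)\<^sup>2 \<partial>M))"
    using t by (simp add: field_simps)
  finally show ?thesis using t by (simp only: mult_le_cancel_left_pos)
qed


section \<open>From near-maximizers to a dual density\<close>

lemma truncation_bounded:
  assumes "AE x in M. v x \<le> C"
  shows "AE x in M. \<bar>max (v x) (- real m)\<bar> \<le> \<bar>C\<bar> + real m"
  using assms by eventually_elim linarith

text \<open>The supremum need not be attained in the cone, so the variational inequalities are
  written for near-maximizers, and only their limits involve a density
  \<open>\<rho>\<close>.\<close>

lemma pen_sup_ge:
  assumes N: "0 < N"
    and dual: "\<And>\<rho>. integrable M \<rho> \<Longrightarrow> (\<And>x. 0 \<le> \<rho> x) \<Longrightarrow>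
      (\<And>v. v \<in> Hs \<Longrightarrow> integrable M (\<lambda>x. \<rho> x * v x) \<and> mass v \<le> (\<integral>x. \<rho> x * v x \<partial>M)) \<Longrightarrow>
      integrable M (\<lambda>x. \<rho> x * q x) \<Longrightarrow> c \<le> - (\<integral>x. \<rho> x * q x \<partial>M)"
    and e: "0 < e"
  shows "\<exists>u\<in>Hs. c - e \<le> pen N u"
proof -
  define S where "S = Sup (pen N ` Hs)"
  have bdd: "bdd_above (pen N ` Hs)" using pen_le[OF _ N] by (auto intro!: bdd_aboveI)
  have S: "pen N w \<le> S" if "w \<in> Hs" for w
    unfolding S_def using that bdd by (auto intro: cSUP_upper)
  have near: "\<exists>u\<in>Hs. S - d < pen N u" if "0 < d" for d
    using less_cSupD[of "pen N ` Hs" "S - d"] Hs_ne that unfolding S_def by auto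
  have "\<exists>u. u \<in> Hs \<and> S - (1/4) ^ k \<le> pen N u" for k :: nat
    using near[of "(1/4) ^ k"] by auto
  then obtain u where u: "\<And>k::nat. u k \<in> Hs" and du: "\<And>k. S - (1/4) ^ k \<le> pen N (u k)"
    by metis
  have dist: "(\<integral>x. \<bar>excess (u (Suc k)) x - excess (u k) x\<bar> \<partial>M)
      \<le> (4 / N + measure M (space M) / 4) * (1/2) ^ k" for k
  proof -
    let ?d = "\<lambda>x. excess (u (Suc k)) x - excess (u k) x"
    have "(1/4::real) ^ Suc k \<le> (1/4) ^ k" by simp
    then have "S - (1/4) ^ k \<le> pen N (u (Suc k))" using du[of "Suc k"] by linarith
    then have d2: "(\<integral>x. (?d x)\<^sup>2 \<partial>M) \<le> 4 * (1/4) ^ k / N"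
      using near_maximizers_close[OF u u N S _ du] by blast
    have i: "integrable M (\<lambda>x. (?d x)\<^sup>2)"
      using integrable_excess_sq[OF u] integrable_excess_excess[OF u u]
      by (simp add: power2_diff mult.assoc)
    \<comment> \<open>The slack \<open>(1/4) ^ k\<close> makes the squared L2 distance of order
      \<open>(1/4) ^ k\<close>. With parameter \<open>2 ^ k\<close> in
      \<open>linear_le_square\<close> both resulting terms are of order \<open>(1/2) ^ k\<close>,
      which is summable.\<close>
    have "(\<integral>x. \<bar>?d x\<bar> \<partial>M) \<le> (\<integral>x. 2 ^ k * (?d x)\<^sup>2 + 1 / (4 * 2 ^ k) \<partial>M)"
    proof (rule integral_mono)
      show "\<bar>?d x\<bar> \<le> 2 ^ k * (?d x)\<^sup>2 + 1 / (4 * 2 ^ k)" for x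
        using linear_le_square[of "2 ^ k" "\<bar>?d x\<bar>"] by simp
    qed (use i integrable_excess[OF u] in auto)
    also have "\<dots> = 2 ^ k * (\<integral>x. (?d x)\<^sup>2 \<partial>M) + measure M (space M) / (4 * 2 ^ k)"
      using i by simp
    also have "\<dots> \<le> 2 ^ k * (4 * (1/4) ^ k / N) + measure M (space M) / (4 * 2 ^ k)"
      using mult_left_mono[OF d2, of "2 ^ k"] by simp
    also have "(4::real) ^ k = 2 ^ k * 2 ^ k" by (simp flip: power_mult_distrib)
    then have "2 ^ k * (4 * (1/4) ^ k / N) + measure M (space M) / (4 * 2 ^ k)
        = (4 / N + measure M (space M) / 4) * (1/2) ^ k"
      by (simp add: power_divide field_simps)
    finally show ?thesis .
  qed
  obtain \<rho>' where \<rho>': "integrable M \<rho>'" "\<And>x. 0 \<le> \<rho>' x"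
    and conv: "\<And>b K. b \<in> borel_measurable M \<Longrightarrow> AE x in M. \<bar>b x\<bar> \<le> K \<Longrightarrow>
       (\<lambda>k. \<integral>x. excess (u k) x * b x \<partial>M) \<longlonglongrightarrow> (\<integral>x. \<rho>' x * b x \<partial>M)"
    by (rule L1_fast_Cauchy_limit[of M "\<lambda>k. excess (u k)", OF integrable_excess[OF u] excess_nonneg dist])
      (rule that)
  \<comment> \<open>The factor \<open>2 * N\<close> comes from differentiating \<open>N\<close>
    times the square of the excess.\<close>
  define \<rho> where "\<rho> = (\<lambda>x. 2 * N * \<rho>' x)"
  have \<rho>: "integrable M \<rho>" "\<And>x. 0 \<le> \<rho> x" unfolding \<rho>_def using \<rho>' N by auto
  have conv\<rho>: "(\<lambda>k. 2 * N * (\<integral>x. excess (u k) x * b x \<partial>M)) \<longlonglongrightarrow> (\<integral>x. \<rho> x * b x \<partial>M)"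
    if "b \<in> borel_measurable M" "AE x in M. \<bar>b x\<bar> \<le> K" for b K
    using tendsto_mult_left[OF conv[OF that], of "2 * N"] by (simp add: \<rho>_def mult.assoc)
  have small: "(\<lambda>k. (1/4) ^ k / t) \<longlonglongrightarrow> 0" for t :: real
    using tendsto_divide_zero[OF LIMSEQ_power_zero[of "1/4 :: real"], of t] by simp
  have jensen: "integrable M (\<lambda>x. \<rho> x * v x) \<and> mass v \<le> (\<integral>x. \<rho> x * v x \<partial>M)" if v: "v \<in> Hs" for v
  proof -
    note [measurable] = borel_measurable_integrable[OF Hs_int[OF v]]
    obtain C where C: "AE x in M. v x \<le> C" using Hs_bdd[OF v] by blast
    show ?thesis
    proof (rule truncation_limit[OF \<rho> _ C])
      fix m :: nat
      define b where "b = (\<lambda>x. max (v x) (- real m))"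
      have b: "b \<in> borel_measurable M" "AE x in M. \<bar>b x\<bar> \<le> \<bar>C\<bar> + real m" "AE x in M. v x \<le> b x"
        using truncation_bounded[OF C, of m] unfolding b_def by auto
      \<comment> \<open>The order of the limits matters: for fixed \<open>t\<close> and
        \<open>m\<close> the slack divided by \<open>t\<close> vanishes as \<open>k\<close> grows;
        then \<open>t\<close> tends to 0 and removes the quadratic remainder; only then does
        \<open>truncation_limit\<close> send \<open>m\<close> to infinity, although the integral of
        the square of \<open>b\<close> may blow up with \<open>m\<close>.\<close>
      have "mass v \<le> (\<integral>x. \<rho> x * b x \<partial>M) + N * t * (\<integral>x. (b x)\<^sup>2 \<partial>M)" if t: "0 < t" for t
      proof (rule LIMSEQ_le_const)
        show "(\<lambda>k. (1/4) ^ k / t + 2 * N * (\<integral>x. excess (u k) x * b x \<partial>M) + N * t * (\<integral>x. (b x)\<^sup>2 \<partial>M))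
          \<longlonglongrightarrow> (\<integral>x. \<rho> x * b x \<partial>M) + N * t * (\<integral>x. (b x)\<^sup>2 \<partial>M)"
          using tendsto_add[OF tendsto_add[OF small conv\<rho>[OF b(1,2)]] tendsto_const] by simp
        show "\<exists>n. \<forall>k\<ge>n. mass v \<le> (1/4) ^ k / t + 2 * N * (\<integral>x. excess (u k) x * b x \<partial>M)
            + N * t * (\<integral>x. (b x)\<^sup>2 \<partial>M)"
          using variation_add[OF u v N t S du b] by blast
      qed
      then have "\<forall>\<^sub>F t in at_right 0. mass v \<le> (\<integral>x. \<rho> x * b x \<partial>M) + N * t * (\<integral>x. (b x)\<^sup>2 \<partial>M)"
        by (intro eventually_at_rightI[of 0 1]) auto
      moreover have "((\<lambda>t. (\<integral>x. \<rho> x * b x \<partial>M) + N * t * (\<integral>x. (b x)\<^sup>2 \<partial>M)) \<longlongrightarrow>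
          (\<integral>x. \<rho> x * b x \<partial>M) + N * 0 * (\<integral>x. (b x)\<^sup>2 \<partial>M)) (at_right 0)"
        by (intro tendsto_intros)
      ultimately show "mass v \<le> (\<integral>x. \<rho> x * max (v x) (- real m) \<partial>M)"
        using tendsto_lowerbound[OF _ _ trivial_limit_at_right_real] by (simp add: b_def)
    qed measurable
  qed
  have dualq: "integrable M (\<lambda>x. \<rho> x * q x) \<and> - S \<le> (\<integral>x. \<rho> x * q x \<partial>M)"
  proof -
    obtain C where C: "AE x in M. q x \<le> C" using q_bdd by blast
    show ?thesis
    proof (rule truncation_limit[OF \<rho> _ C])
      fix m :: nat
      define b where "b = (\<lambda>x. max (q x) (- real m))"
      have b: "b \<in> borel_measurable M" "AE x in M. \<bar>b x\<bar> \<le> \<bar>C\<bar> + real m" "AE x in M. q x \<le> b x"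
        using truncation_bounded[OF C, of m] unfolding b_def by auto
      have "- S \<le> (1 - t) * (\<integral>x. \<rho> x * b x \<partial>M) + N * t * (\<integral>x. (b x)\<^sup>2 \<partial>M)"
        if t: "0 < t" "t < 1" for t
      proof (rule LIMSEQ_le_const)
        show "(\<lambda>k. (1/4) ^ k / t + (1 - t) * (2 * N * (\<integral>x. excess (u k) x * b x \<partial>M))
            + N * t * (\<integral>x. (b x)\<^sup>2 \<partial>M))
          \<longlonglongrightarrow> (1 - t) * (\<integral>x. \<rho> x * b x \<partial>M) + N * t * (\<integral>x. (b x)\<^sup>2 \<partial>M)"
          using tendsto_add[OF tendsto_add[OF small tendsto_mult_left[OF conv\<rho>[OF b(1,2)]]] tendsto_const]
          by simp
        show "\<exists>n. \<forall>k\<ge>n. - S \<le> (1/4) ^ k / t + (1 - t) * (2 * N * (\<integral>x. excess (u k) x * b x \<partial>M))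
            + N * t * (\<integral>x. (b x)\<^sup>2 \<partial>M)"
        proof (intro exI allI impI)
          fix k
          show "- S \<le> (1/4) ^ k / t + (1 - t) * (2 * N * (\<integral>x. excess (u k) x * b x \<partial>M))
            + N * t * (\<integral>x. (b x)\<^sup>2 \<partial>M)"
            using variation_shrink[OF u N t S du b, of k] S[OF u, of k] by (simp add: algebra_simps)
        qed
      qed
      then have "\<forall>\<^sub>F t in at_right 0. - S \<le> (1 - t) * (\<integral>x. \<rho> x * b x \<partial>M) + N * t * (\<integral>x. (b x)\<^sup>2 \<partial>M)"
        by (intro eventually_at_rightI[of 0 1]) auto
      moreover have "((\<lambda>t. (1 - t) * (\<integral>x. \<rho> x * b x \<partial>M) + N * t * (\<integral>x. (b x)\<^sup>2 \<partial>M)) \<longlongrightarrow>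
          (1 - 0) * (\<integral>x. \<rho> x * b x \<partial>M) + N * 0 * (\<integral>x. (b x)\<^sup>2 \<partial>M)) (at_right 0)"
        by (intro tendsto_intros)
      ultimately show "- S \<le> (\<integral>x. \<rho> x * max (q x) (- real m) \<partial>M)"
        using tendsto_lowerbound[OF _ _ trivial_limit_at_right_real] by (simp add: b_def)
    qed measurable
  qed
  have "c \<le> S" using dual[OF \<rho> jensen conjunct1[OF dualq]] conjunct2[OF dualq] by linarith
  moreover obtain u' where "u' \<in> Hs" "S - e < pen N u'" using near[OF e] by blast
  ultimately show ?thesis by (intro bexI[of _ u']) auto
qed

lemma approximate_majorized:
  assumes dual: "\<And>\<rho>. integrable M \<rho> \<Longrightarrow> (\<And>x. 0 \<le> \<rho> x) \<Longrightarrow>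
      (\<And>v. v \<in> Hs \<Longrightarrow> integrable M (\<lambda>x. \<rho> x * v x) \<and> mass v \<le> (\<integral>x. \<rho> x * v x \<partial>M)) \<Longrightarrow>
      integrable M (\<lambda>x. \<rho> x * q x) \<Longrightarrow> c \<le> - (\<integral>x. \<rho> x * q x \<partial>M)"
    and e: "0 < e"
  obtains u where "u \<in> Hs" "c - e \<le> mass u" "(\<integral>x. excess u x \<partial>M) \<le> e"
proof -
  define V where "V = measure M (space M)"
  define T where "T = \<bar>e - c - mass q\<bar>"
  have V0: "0 \<le> V" by (simp add: V_def)
  \<comment> \<open>The penalty weight will be \<open>s\<^sup>2\<close>, and
    \<open>integral_excess_le\<close> is applied twice. Parameter \<open>s\<^sup>2 / 2\<close> lets
    half of the penalty absorb \<open>I1\<close> and yields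
    \<open>s\<^sup>2 * I2 \<le> 2 * (T + V)\<close>; parameter \<open>s / 2\<close> then yields
    \<open>s * I1 \<le> T + 2 * V\<close>. The choice of \<open>s\<close> makes this at most
    \<open>s * e\<close>.\<close>
  define s where "s = 1 + (T + 2 * V) / e"
  have s: "1 \<le> s" using e V0 by (simp add: s_def T_def)
  have N: "0 < s\<^sup>2" using s by simp
  obtain u where u: "u \<in> Hs" "c - e \<le> pen (s\<^sup>2) u" using pen_sup_ge[OF N dual e] by blast
  define I2 where "I2 = (\<integral>x. (excess u x)\<^sup>2 \<partial>M)"
  define I1 where "I1 = (\<integral>x. excess u x \<partial>M)"
  have I2: "0 \<le> I2" by (simp add: I2_def)
  have a: "c - e \<le> mass u - s\<^sup>2 * I2" using u(2) by (simp add: pen_def I2_def)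
  have b: "mass u \<le> - mass q + I1" using mass_le[OF u(1)] by (simp add: I1_def)
  have "I1 \<le> (s\<^sup>2 / 2) * I2 + V / (4 * (s\<^sup>2 / 2))"
    using integral_excess_le[OF u(1), of "s\<^sup>2 / 2"] N by (simp add: I1_def I2_def V_def)
  also have "V / (4 * (s\<^sup>2 / 2)) \<le> V / 1"
    using V0 one_le_power[OF s, of 2] by (intro divide_left_mono) auto
  finally have d: "I1 \<le> s\<^sup>2 / 2 * I2 + V" by simp
  have sI: "s\<^sup>2 * I2 \<le> 2 * (T + V)" using a b d abs_ge_self[of "e - c - mass q"] unfolding T_def by argo
  have "I1 \<le> (s / 2) * I2 + V / (4 * (s / 2))"
    using integral_excess_le[OF u(1), of "s / 2"] s by (simp add: I1_def I2_def V_def)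
  then have "s * I1 \<le> s * ((s / 2) * I2 + V / (4 * (s / 2)))" using s by simp
  also have "\<dots> = s\<^sup>2 * I2 / 2 + V / 2" using s by (simp add: field_simps power2_eq_square)
  also have "\<dots> \<le> T + 2 * V" using sI V0 by simp
  also have "\<dots> \<le> s * e" using e by (simp add: s_def field_simps)
  finally have "I1 \<le> e" using s by simp
  moreover have "c - e \<le> mass u" using a I2 N by (smt (verit) mult_nonneg_nonneg zero_le_power2)
  ultimately show ?thesis using that u(1) by (simp add: I1_def)
qed

end

section \<open>Integrals of upper semicontinuous and subharmonic functions\<close>

text \<open>Junk value: \<open>rval D u x = 0\<close> where \<open>u x\<close> is infinite; for the functions below this is a null set.\<close>
definition rval :: "'a set \<Rightarrow> ('a \<Rightarrow> ereal) \<Rightarrow> 'a \<Rightarrow> real" where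
  "rval D u x = (if x \<in> D then real_of_ereal (u x) else 0)"

text \<open>A density on the whole space keeps the Borel sets as measurable sets. Lebesgue measure
  on a compact \<open>K\<close> thus becomes a finite Borel measure of the same kind as the members
  of \<open>JH\<close>, and the same integrability lemmas serve both.\<close>

abbreviation lborel_in :: "'a::euclidean_space set \<Rightarrow> 'a measure" where
  "lborel_in K \<equiv> density lborel (\<lambda>x. ennreal (indicator K x))"

lemma usc_on_open_less:
  assumes "open D" "usc_on D u" shows "open {x \<in> D. u x < ereal c}"
  unfolding open_contains_ball
proof
  fix x assume "x \<in> {x \<in> D. u x < ereal c}"
  then have x: "x \<in> D" "u x < ereal c" by auto
  then obtain e where e: "0 < e" "\<forall>y\<in>ball x e \<inter> D. u y < ereal c"
    using assms(2) unfolding usc_on_def by blast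
  obtain e' where e': "0 < e'" "ball x e' \<subseteq> D" using assms(1) x(1) openE by blast
  have "ball x (min e e') \<subseteq> {x \<in> D. u x < ereal c}" using e(2) e'(2) by auto
  then show "\<exists>e>0. ball x e \<subseteq> {x \<in> D. u x < ereal c}"
    using e(1) e'(1) by (intro exI[of _ "min e e'"]) auto
qed

lemma usc_on_measurable:
  assumes "open D" "usc_on D u" "\<forall>x\<in>D. u x < \<infinity>"
  shows "(\<lambda>x. if x \<in> D then u x else 0) \<in> borel_measurable borel"
proof (rule borel_measurableI_less)
  fix y :: ereal
  have "open {x \<in> D. u x < y}"
  proof (cases y)
    case PInf
    then have "{x \<in> D. u x < y} = D" using assms(3) by auto
    then show ?thesis using assms(1) by simp
  qed (use usc_on_open_less[OF assms(1,2)] in auto)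
  moreover have "{x \<in> space borel. (if x \<in> D then u x else 0) < y}
      = {x \<in> D. u x < y} \<union> (if 0 < y then - D else {})"
    by auto
  ultimately show "{x \<in> space borel. (if x \<in> D then u x else 0) < y} \<in> sets borel"
    using assms(1) by simp
qed

lemma rval_measurable:
  assumes "open D" "usc_on D u" "\<forall>x\<in>D. u x < \<infinity>"
  shows "rval D u \<in> borel_measurable borel"
proof -
  have "rval D u = (\<lambda>x. real_of_ereal (if x \<in> D then u x else 0))"
    by (auto simp: rval_def)
  then show ?thesis using usc_on_measurable[OF assms] by simp
qed

lemma usc_on_bounded_compact:
  assumes "open D" "usc_on D u" "\<forall>x\<in>D. u x < \<infinity>" "compact K" "K \<subseteq> D"
  obtains C :: real where "0 \<le> C" "\<And>x. x \<in> K \<Longrightarrow> u x \<le> ereal C"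
proof -
  have "K \<subseteq> (\<Union>n\<in>UNIV. {x \<in> D. u x < ereal (real n)})"
  proof
    fix x assume "x \<in> K"
    then have x: "x \<in> D" "u x < \<infinity>" using assms by auto
    then obtain n :: nat where "u x < ereal (real n)" using less_PInf_Ex_of_nat by auto
    then show "x \<in> (\<Union>n\<in>UNIV. {x \<in> D. u x < ereal (real n)})" using x by auto
  qed
  then obtain F where F: "finite F" "K \<subseteq> (\<Union>n\<in>F. {x \<in> D. u x < ereal (real n)})"
    using compactE_image[OF assms(4), of UNIV "\<lambda>n. {x \<in> D. u x < ereal (real n)}"]
      usc_on_open_less[OF assms(1,2)] by metis
  show ?thesis
  proof (rule that[of "real (Max (insert 0 F))"])
    fix x assume "x \<in> K"
    then obtain n where n: "n \<in> F" "u x < ereal (real n)" using F by auto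
    then have "ereal (real n) \<le> ereal (real (Max (insert 0 F)))" using F(1) by simp
    then show "u x \<le> ereal (real (Max (insert 0 F)))" using n(2) by (meson less_le_trans less_imp_le)
  qed simp
qed

lemma e2ennreal_max_ereal: "e2ennreal (max 0 (ereal a)) = ennreal a"
  by (simp add: max_def ennreal_neg zero_ereal_def)

lemma eint_eq_integral:
  assumes ae: "AE x in \<mu>. x \<in> D \<and> u x = ereal (v x)" and v: "integrable \<mu> v"
  shows "eint \<mu> D u = ereal (\<integral>x. v x \<partial>\<mu>)"
proof -
  have p: "(\<integral>\<^sup>+x. e2ennreal (max 0 (u x)) * indicator D x \<partial>\<mu>) = (\<integral>\<^sup>+x. ennreal (v x) \<partial>\<mu>)"
    by (rule nn_integral_cong_AE, use ae in eventually_elim) (simp add: e2ennreal_max_ereal)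
  have n: "(\<integral>\<^sup>+x. e2ennreal (max 0 (- u x)) * indicator D x \<partial>\<mu>) = (\<integral>\<^sup>+x. ennreal (- v x) \<partial>\<mu>)"
    by (rule nn_integral_cong_AE, use ae in eventually_elim) (simp add: e2ennreal_max_ereal)
  have f: "(\<integral>\<^sup>+x. ennreal (v x) \<partial>\<mu>) \<noteq> \<infinity>" "(\<integral>\<^sup>+x. ennreal (- v x) \<partial>\<mu>) \<noteq> \<infinity>"
    using v by (auto simp: real_integrable_def)
  have e: "enn2ereal a = ereal (enn2real a)" if "a \<noteq> \<infinity>" for a
    using that by (cases a) (auto simp: enn2ereal_ennreal)
  show ?thesis
    unfolding eint_def p n e[OF f(1)] e[OF f(2)] real_lebesgue_integral_def[OF v] by simp
qed

text \<open>Upper semicontinuity bounds \<open>u\<close> above on the compact set that carries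
  \<open>\<mu>\<close>, so the positive part has finite integral. An integral different from minus
  infinity then forces the negative part to be integrable too.\<close>

lemma eint_finite_imp_integrable:
  assumes u: "open D" "usc_on D u" "\<forall>x\<in>D. u x < \<infinity>"
    and \<mu>: "finite_measure \<mu>" "sets \<mu> = sets borel"
    and K: "compact K" "K \<subseteq> D" "AE x in \<mu>. x \<in> K"
    and fin: "eint \<mu> D u \<noteq> -\<infinity>"
  shows "integrable \<mu> (rval D u)"
    and "AE x in \<mu>. x \<in> D \<and> u x = ereal (rval D u x)"
    and "eint \<mu> D u = ereal (\<integral>x. rval D u x \<partial>\<mu>)"
proof -
  interpret finite_measure \<mu> by fact
  define u' where "u' = (\<lambda>x. if x \<in> D then u x else 0)"
  have [measurable]: "u' \<in> borel_measurable \<mu>" "rval D u \<in> borel_measurable \<mu>"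
    using usc_on_measurable[OF u] rval_measurable[OF u] \<mu>(2) measurable_cong_sets
    unfolding u'_def by blast+
  obtain C where C: "0 \<le> C" "\<And>x. x \<in> K \<Longrightarrow> u x \<le> ereal C"
    using usc_on_bounded_compact[OF u K(1,2)] by blast
  define P where "P = (\<integral>\<^sup>+x. e2ennreal (max 0 (u x)) * indicator D x \<partial>\<mu>)"
  define N where "N = (\<integral>\<^sup>+x. e2ennreal (max 0 (- u x)) * indicator D x \<partial>\<mu>)"
  have "P \<le> (\<integral>\<^sup>+x. ennreal C \<partial>\<mu>)"
    unfolding P_def
  proof (rule nn_integral_mono_AE)
    show "AE x in \<mu>. e2ennreal (max 0 (u x)) * indicator D x \<le> ennreal C"
      using K(3)
    proof eventually_elim
      case (elim x)
      then have "max 0 (u x) \<le> ereal C" using C by simp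
      then have "e2ennreal (max 0 (u x)) \<le> e2ennreal (ereal C)" by (rule e2ennreal_mono)
      then show ?case by (simp add: indicator_def)
    qed
  qed
  also have "\<dots> < \<infinity>"
    using emeasure_finite[of "space \<mu>"] by (simp add: ennreal_mult_eq_top_iff less_top[symmetric])
  finally have P: "P < \<infinity>" .
  have N: "N \<noteq> \<infinity>"
  proof
    assume "N = \<infinity>"
    then have "eint \<mu> D u = -\<infinity>"
      using P unfolding eint_def P_def[symmetric] N_def[symmetric]
      by (cases P) (auto simp: enn2ereal_ennreal)
    then show False using fin by simp
  qed
  have Neq: "N = (\<integral>\<^sup>+x. e2ennreal (max 0 (- u' x)) \<partial>\<mu>)"
    unfolding N_def by (intro nn_integral_cong) (simp add: u'_def indicator_def zero_ennreal_def[symmetric])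
  have "AE x in \<mu>. e2ennreal (max 0 (- u' x)) \<noteq> \<infinity>"
    using N unfolding Neq by (intro nn_integral_noteq_infinite) auto
  then show ae: "AE x in \<mu>. x \<in> D \<and> u x = ereal (rval D u x)"
    using K(3)
  proof eventually_elim
    case (elim x)
    have xD: "x \<in> D" using elim K by auto
    then have "u x \<noteq> -\<infinity>" using elim(1) by (auto simp: u'_def)
    moreover have "u x \<noteq> \<infinity>" using u(3) xD by auto
    ultimately show ?case using xD by (cases "u x") (auto simp: rval_def)
  qed
  have "(\<integral>\<^sup>+x. ennreal (- rval D u x) \<partial>\<mu>) = N"
    unfolding N_def by (rule nn_integral_cong_AE, use ae in eventually_elim)
      (simp add: e2ennreal_max_ereal)
  moreover have "(\<integral>\<^sup>+x. ennreal (rval D u x) \<partial>\<mu>) = P"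
    unfolding P_def by (rule nn_integral_cong_AE, use ae in eventually_elim)
      (simp add: e2ennreal_max_ereal)
  ultimately show i: "integrable \<mu> (rval D u)"
    using P N by (auto simp: real_integrable_def)
  show "eint \<mu> D u = ereal (\<integral>x. rval D u x \<partial>\<mu>)" using eint_eq_integral[OF ae i] .
qed

lemma eint_lebesgue:
  assumes u: "open D" "usc_on D u" "\<forall>x\<in>D. u x < \<infinity>" and K: "K \<in> sets borel" "K \<subseteq> D"
  shows "eint lebesgue K u = eint (lborel_in K) D u"
proof -
  note [measurable] = usc_on_measurable[OF u] K(1)
  \<comment> \<open>The sign \<open>s\<close> treats the positive and the negative part of
    \<open>u\<close> in one computation.\<close>
  have "(\<integral>\<^sup>+x. e2ennreal (max 0 (s * u x)) * indicator K x \<partial>lebesgue)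
      = (\<integral>\<^sup>+x. e2ennreal (max 0 (s * u x)) * indicator D x \<partial>lborel_in K)"
    if "s = 1 \<or> s = -1" for s :: ereal
  proof -
    have "(\<integral>\<^sup>+x. e2ennreal (max 0 (s * u x)) * indicator D x \<partial>lborel_in K)
      = (\<integral>\<^sup>+x. e2ennreal (max 0 (s * (if x \<in> D then u x else 0))) \<partial>lborel_in K)"
      by (intro nn_integral_cong) (simp add: indicator_def zero_ennreal_def[symmetric])
    also have "\<dots> = (\<integral>\<^sup>+x. ennreal (indicator K x) * e2ennreal (max 0 (s * (if x \<in> D then u x else 0))) \<partial>lborel)"
      using that by (intro nn_integral_density) auto
    also have "\<dots> = (\<integral>\<^sup>+x. e2ennreal (max 0 (s * u x)) * indicator K x \<partial>lborel)"
      using K(2) by (intro nn_integral_cong) (auto simp: indicator_def)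
    finally show ?thesis by (simp add: nn_integral_completion)
  qed
  from this[of 1] this[of "-1"] show ?thesis unfolding eint_def by simp
qed

lemma emeasure_space_lborel_in:
  assumes "K \<in> sets borel"
  shows "emeasure (lborel_in K) (space (lborel_in K)) = emeasure lborel K"
  using assms by (simp add: emeasure_density ennreal_indicator)

lemma finite_measure_lborel_in:
  assumes "compact K" shows "finite_measure (lborel_in K)"
proof (rule finite_measureI)
  have "emeasure (lborel_in K) (space (lborel_in K)) = emeasure lborel K"
    using assms by (intro emeasure_space_lborel_in) (simp add: compact_imp_closed)
  then show "emeasure (lborel_in K) (space (lborel_in K)) \<noteq> \<infinity>"
    using emeasure_compact_finite[OF assms] by auto
qed

lemma AE_lborel_in:
  assumes "K \<in> sets borel"
  shows "(AE x in lborel_in K. P x) \<longleftrightarrow> (AE x in lborel. x \<in> K \<longrightarrow> P x)"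
  using assms by (subst AE_density) (auto simp: indicator_def)

lemma integrable_lborel_in:
  fixes v :: "'a::euclidean_space \<Rightarrow> real"
  assumes "K \<in> sets borel" "v \<in> borel_measurable borel"
  shows "integrable (lborel_in K) v \<longleftrightarrow> set_integrable lborel K v"
    and "integral\<^sup>L (lborel_in K) v = (LINT x:K|lborel. v x)"
  using assms by (auto simp: set_integrable_def set_lebesgue_integral_def integrable_density integral_density)

section \<open>Local integrability of subharmonic functions\<close>

definition proper_sbh :: "'a::euclidean_space set \<Rightarrow> ('a \<Rightarrow> ereal) \<Rightarrow> bool" where
  "proper_sbh D u \<longleftrightarrow> sbh D u \<and> (\<exists>x\<in>D. u x \<noteq> -\<infinity>)"

lemma sbhD:
  assumes "sbh D u"
  shows "usc_on D u" "\<forall>x\<in>D. u x < \<infinity>"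
    and "0 < r \<Longrightarrow> cball x r \<subseteq> D \<Longrightarrow>
      ereal (measure lebesgue (cball x r)) * u x \<le> eint lebesgue (cball x r) u"
  using assms by (simp_all add: sbh_def)

lemma eint_cball_finite:
  assumes "open D" "sbh D u" "0 < r" "cball x r \<subseteq> D" "u x \<noteq> -\<infinity>"
  shows "eint (lborel_in (cball x r)) D u \<noteq> -\<infinity>"
proof -
  have "x \<in> D" using assms by auto
  then have "u x < \<infinity>" using sbhD(2)[OF assms(2)] by auto
  then obtain a where "u x = ereal a" using assms(5) by (cases "u x") auto
  then have "ereal (measure lebesgue (cball x r) * a) \<le> eint lebesgue (cball x r) u"
    using sbhD(3)[OF assms(2-4)] by simp
  then show ?thesis
    using eint_lebesgue[OF assms(1) sbhD(1,2)[OF assms(2)], of "cball x r"] assms(4) by auto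
qed

lemma set_integrable_sbh_cball:
  assumes "open D" "sbh D u" "0 < r" "cball x r \<subseteq> D" "u x \<noteq> -\<infinity>"
  shows "set_integrable lborel (cball x r) (rval D u)"
    and "AE y in lborel. y \<in> cball x r \<longrightarrow> u y \<noteq> -\<infinity>"
proof -
  note u = assms(1) sbhD(1,2)[OF assms(2)]
  have ae: "AE y in lborel_in (cball x r). y \<in> cball x r" by (simp add: AE_lborel_in)
  note * = eint_finite_imp_integrable[OF u finite_measure_lborel_in _ _ assms(4) ae eint_cball_finite[OF assms]]
  show "set_integrable lborel (cball x r) (rval D u)"
    using * integrable_lborel_in(1)[OF _ rval_measurable[OF u]] by simp
  have "AE y in lborel_in (cball x r). y \<in> D \<and> u y = ereal (rval D u y)" using * by simp
  then show "AE y in lborel. y \<in> cball x r \<longrightarrow> u y \<noteq> -\<infinity>"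
    unfolding AE_lborel_in[OF borel_closed[OF closed_cball]] by (rule eventually_mono) auto
qed

lemma AE_ball_point:
  fixes x :: "'a::euclidean_space"
  assumes "AE y in lborel. y \<in> ball x e \<longrightarrow> P y" "0 < e"
  obtains y where "y \<in> ball x e" "P y"
proof (rule ccontr)
  assume "\<not> thesis"
  then have "\<forall>y\<in>ball x e. \<not> P y" using that by blast
  then have "AE y in lborel. y \<notin> ball x e" by (intro eventually_mono[OF assms(1)]) auto
  then have "emeasure lborel (ball x e) = 0"
    using AE_iff_null_sets[of "ball x e" lborel] by auto
  then have "measure lborel (ball x e) = 0" by (simp add: measure_def)
  then show False using content_ball_pos[OF assms(2), of x] by simp
qed

text \<open>A point near which \<open>u\<close> is integrable has arbitrarily close points of finiteness, and
  larger balls around those are governed by the sub-mean value inequality; so the set of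
  points near which \<open>u\<close> is finite a.e. is both open and closed in the domain.\<close>
lemma proper_sbh_locally_integrable:
  assumes D: "open D" "connected D" and u: "proper_sbh D u" and x: "x \<in> D"
  obtains e where "0 < e" "cball x e \<subseteq> D" "set_integrable lborel (cball x e) (rval D u)"
    "AE y in lborel. y \<in> cball x e \<longrightarrow> u y \<noteq> -\<infinity>"
proof -
  have su: "sbh D u" and nt: "\<exists>x\<in>D. u x \<noteq> -\<infinity>" using u unfolding proper_sbh_def by auto
  define Q where "Q x e \<longleftrightarrow> 0 < e \<and> cball x e \<subseteq> D \<and> set_integrable lborel (cball x e) (rval D u)
    \<and> (AE y in lborel. y \<in> cball x e \<longrightarrow> u y \<noteq> -\<infinity>)" for x e
  define E where "E = {x. \<exists>e. Q x e}"
  have sub: "Q y e'" if "Q z e" "cball y e' \<subseteq> cball z e" "0 < e'" for y z e e'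
  proof -
    have "AE w in lborel. w \<in> cball y e' \<longrightarrow> u w \<noteq> -\<infinity>"
      using that(1) unfolding Q_def using that(2) by (auto elim: eventually_mono simp del: mem_cball)
    moreover have "set_integrable lborel (cball y e') (rval D u)"
      using that(1) unfolding Q_def using that(2) by (auto intro: set_integrable_subset)
    ultimately show ?thesis using that unfolding Q_def by blast
  qed
  have fin: "Q z e" if "0 < e" "cball z e \<subseteq> D" "u z \<noteq> -\<infinity>" for z e
    using set_integrable_sbh_cball[OF D(1) su that] that unfolding Q_def by auto
  have ED: "E \<subseteq> D" unfolding E_def Q_def by auto
  have oE: "open E"
    unfolding open_contains_ball
  proof
    fix z assume "z \<in> E"
    then obtain e where e: "Q z e" by (auto simp: E_def)
    then have e0: "0 < e" by (simp add: Q_def)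
    have "y \<in> E" if "y \<in> ball z (e/2)" for y
    proof -
      have "cball y (e/2) \<subseteq> cball z e" using that by (simp add: cball_subset_cball_iff dist_commute)
      then show ?thesis using sub[OF e, of y "e/2"] e0 by (auto simp: E_def)
    qed
    then show "\<exists>e>0. ball z e \<subseteq> E" using e0 by (intro exI[of _ "e/2"]) auto
  qed
  have oC: "open (D - E)"
    unfolding open_contains_ball
  proof
    fix z assume z: "z \<in> D - E"
    then obtain s where s: "0 < s" "ball z s \<subseteq> D" using D(1) openE by blast
    \<comment> \<open>A point \<open>w\<close> within \<open>t\<close> of \<open>z\<close> has
      \<open>cball w (2 * t)\<close> inside the ball of radius \<open>3 * t\<close> about
      \<open>z\<close>, hence inside \<open>ball z s\<close>; at the same time this ball covers
      \<open>cball z t\<close>.\<close>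
    define t where "t = s / 4"
    have t: "0 < t" using s by (simp add: t_def)
    have "y \<notin> E" if y: "y \<in> ball z t" for y
    proof
      assume "y \<in> E"
      then obtain e where e: "Q y e" by (auto simp: E_def)
      \<comment> \<open>Small enough for both purposes: \<open>u\<close> is finite a.e. on
        \<open>ball y e'\<close>, and the finite point found there stays within \<open>t\<close> of
        \<open>z\<close>.\<close>
      define e' where "e' = min e (t - dist z y)"
      have e': "0 < e'" "ball y e' \<subseteq> cball y e" using e y by (auto simp: Q_def e'_def)
      have e'3: "ball y e' \<subseteq> ball z t"
      proof -
        have "e' \<le> t - dist z y" by (simp add: e'_def)
        then show ?thesis by (simp add: ball_subset_ball_iff dist_commute)
      qed
      have "AE w in lborel. w \<in> cball y e \<longrightarrow> u w \<noteq> -\<infinity>" using e by (simp add: Q_def)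
      then have "AE w in lborel. w \<in> ball y e' \<longrightarrow> u w \<noteq> -\<infinity>"
        using e'(2) by (elim eventually_mono) blast
      then obtain w where w: "w \<in> ball y e'" "u w \<noteq> -\<infinity>"
        by (rule AE_ball_point[OF _ e'(1)])
      have "w \<in> ball z t" using w(1) e'3 by blast
      then have wz: "dist w z < t" by (simp add: dist_commute)
      have "cball w (2 * t) \<subseteq> ball z s"
        using wz t by (simp add: cball_subset_ball_iff t_def)
      then have "Q w (2 * t)" using w s t by (intro fin) auto
      moreover have "cball z t \<subseteq> cball w (2 * t)"
        using wz by (simp add: cball_subset_cball_iff dist_commute)
      ultimately have "Q z t" using t by (rule sub)
      then show False using z by (auto simp: E_def)
    qed
    then show "\<exists>e>0. ball z e \<subseteq> D - E" using t s(2) by (intro exI[of _ t]) (auto simp: t_def)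
  qed
  obtain z where z: "z \<in> D" "u z \<noteq> -\<infinity>" using nt by blast
  then obtain e where "0 < e" "cball z e \<subseteq> D" using D(1) open_contains_cball by blast
  then have "z \<in> E" using fin z by (auto simp: E_def)
  then have "D - E = {}"
    using connectedD[OF D(2) oE oC] z(1) by blast
  then have "x \<in> E" using x by blast
  then show ?thesis using that unfolding E_def Q_def by blast
qed

lemma proper_sbh_on_compact:
  assumes D: "open D" "connected D" and u: "proper_sbh D u" and K: "compact K" "K \<subseteq> D"
  shows "set_integrable lborel K (rval D u)" and "AE y in lborel. y \<in> K \<longrightarrow> u y \<noteq> -\<infinity>"
proof -
  have "\<forall>x\<in>K. \<exists>e>0. set_integrable lborel (cball x e) (rval D u) \<and>
    (AE y in lborel. y \<in> cball x e \<longrightarrow> u y \<noteq> -\<infinity>)"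
    using proper_sbh_locally_integrable[OF D u] K(2) by (metis subsetD)
  then obtain e where e: "\<And>x. x \<in> K \<Longrightarrow> 0 < e x"
    "\<And>x. x \<in> K \<Longrightarrow> set_integrable lborel (cball x (e x)) (rval D u)"
    "\<And>x. x \<in> K \<Longrightarrow> AE y in lborel. y \<in> cball x (e x) \<longrightarrow> u y \<noteq> -\<infinity>"
    by metis
  have "K \<subseteq> (\<Union>x\<in>K. ball x (e x))" using e(1) by force
  then obtain F where F: "F \<subseteq> K" "finite F" "K \<subseteq> (\<Union>x\<in>F. ball x (e x))"
    using compactE_image[OF K(1), of K "\<lambda>x. ball x (e x)"] by auto
  have sub: "K \<subseteq> (\<Union>x\<in>F. cball x (e x))" using F(3) ball_subset_cball by blast
  have "set_integrable lborel (\<Union>x\<in>F. cball x (e x)) (rval D u)"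
    using F e(2) by (intro set_integrable_UN) auto
  then show "set_integrable lborel K (rval D u)"
    by (rule set_integrable_subset) (use sub K(1) in \<open>auto simp: compact_imp_closed\<close>)
  have "AE y in lborel. \<forall>x\<in>F. y \<in> cball x (e x) \<longrightarrow> u y \<noteq> -\<infinity>"
    using F e(3) by (intro AE_finite_allI) auto
  then show "AE y in lborel. y \<in> K \<longrightarrow> u y \<noteq> -\<infinity>"
    using sub by (elim eventually_mono) blast
qed

text \<open>An open set is a countable union of compact sets, on each of which the value minus
  infinity is taken only on a null set. The default value in \<open>rval\<close> is therefore
  invisible to Lebesgue integrals.\<close>

lemma proper_sbh_AE:
  assumes D: "open D" "connected D" and u: "proper_sbh D u"
  shows "AE x in lborel. x \<in> D \<longrightarrow> u x = ereal (rval D u x)"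
proof -
  obtain K :: "nat \<Rightarrow> 'a set" where K: "\<And>n. compact (K n)" "\<And>n. K n \<subseteq> D" "\<Union>(range K) = D"
    using open_Union_compact_subsets[OF D(1)] by metis
  have "AE x in lborel. \<forall>n. x \<in> K n \<longrightarrow> u x \<noteq> -\<infinity>"
    unfolding AE_all_countable using proper_sbh_on_compact(2)[OF D u K(1,2)] by blast
  then show ?thesis
  proof eventually_elim
    case (elim x)
    show ?case
    proof
      assume x: "x \<in> D"
      then have "u x \<noteq> -\<infinity>" using elim K(3) by blast
      moreover have "u x < \<infinity>" using u x sbhD(2) unfolding proper_sbh_def by blast
      ultimately show "u x = ereal (rval D u x)" using x by (cases "u x") (auto simp: rval_def)
    qed
  qed
qed

lemma proper_sbh_eint:
  assumes D: "open D" "connected D" and u: "proper_sbh D u" and K: "compact K" "K \<subseteq> D"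
  shows "eint lebesgue K u = ereal (LINT x:K|lborel. rval D u x)"
proof -
  have su: "sbh D u" using u by (simp add: proper_sbh_def)
  have Kb: "K \<in> sets borel" using K(1) by (simp add: compact_imp_closed)
  note m = rval_measurable[OF D(1) sbhD(1,2)[OF su]]
  have "AE x in lborel_in K. x \<in> D \<and> u x = ereal (rval D u x)"
    unfolding AE_lborel_in[OF Kb] using proper_sbh_AE[OF D u] K(2) by (elim eventually_mono) blast
  then have "eint (lborel_in K) D u = ereal (integral\<^sup>L (lborel_in K) (rval D u))"
    using integrable_lborel_in(1)[OF Kb m] proper_sbh_on_compact(1)[OF D u K]
    by (intro eint_eq_integral) auto
  then show ?thesis
    using eint_lebesgue[OF D(1) sbhD(1,2)[OF su] Kb K(2)] integrable_lborel_in(2)[OF Kb m] by simp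
qed

lemma proper_sbh_mean:
  assumes D: "open D" "connected D" and u: "proper_sbh D u" and r: "0 < r" "cball x r \<subseteq> D"
  shows "ereal (measure lborel (cball x r)) * u x \<le> ereal (LINT y:cball x r|lborel. rval D u y)"
  using sbhD(3)[OF _ r, of u] u proper_sbh_eint[OF D u _ r(2)]
  by (simp add: proper_sbh_def)

lemma proper_sbh_bounded:
  assumes D: "open D" and u: "proper_sbh D u" and K: "compact K" "K \<subseteq> D"
  obtains C where "0 \<le> C" "\<And>x. x \<in> K \<Longrightarrow> u x \<le> ereal C" "\<And>x. x \<in> K \<Longrightarrow> rval D u x \<le> C"
proof -
  have su: "sbh D u" using u by (simp add: proper_sbh_def)
  obtain C where C: "0 \<le> C" "\<And>x. x \<in> K \<Longrightarrow> u x \<le> ereal C"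
    using usc_on_bounded_compact[OF D sbhD(1,2)[OF su] K] by blast
  have "rval D u x \<le> C" if "x \<in> K" for x
    using C(1) C(2)[OF that] by (cases "u x") (auto simp: rval_def)
  then show ?thesis using C that by blast
qed

section \<open>From inequalities almost everywhere to inequalities everywhere\<close>

lemma usc_add_continuous_less:
  assumes D: "open D" and g: "continuous_on D g" and u: "usc_on D u" and x: "x \<in> D"
    and less: "ereal (g x) + u x < ereal c"
  obtains e where "0 < e" "cball x e \<subseteq> D" "\<And>y. y \<in> cball x e \<Longrightarrow> ereal (g y) + u y < ereal c"
proof -
  have "u x < ereal (c - g x)" using less by (cases "u x") auto
  then obtain d where d: "u x < ereal d" "ereal d < ereal (c - g x)" using ereal_dense2 by blast
  obtain e1 where e1: "0 < e1" "ball x e1 \<subseteq> {y \<in> D. u y < ereal d}"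
    using usc_on_open_less[OF D u, of d] x d(1) openE by blast
  have "isCont g x" using g D x continuous_on_eq_continuous_at by blast
  moreover have "0 < c - g x - d" using d(2) by simp
  ultimately obtain e2 where e2: "0 < e2" "\<forall>y. dist y x < e2 \<longrightarrow> dist (g y) (g x) < c - g x - d"
    unfolding continuous_at by (metis (no_types, lifting) continuous_at continuous_at_eps_delta)
  show ?thesis
  proof (rule that[of "min e1 e2 / 2"])
    have sub: "cball x (min e1 e2 / 2) \<subseteq> ball x (min e1 e2)"
      using e1(1) e2(1) by (auto simp: min_def)
    then show "cball x (min e1 e2 / 2) \<subseteq> D" using e1(2) by force
    fix y assume "y \<in> cball x (min e1 e2 / 2)"
    then have y: "dist x y < e1" "dist x y < e2" using sub by auto
    then have "u y < ereal d" "g y - g x < c - g x - d"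
      using e1(2) e2(2) by (auto simp: dist_commute dist_real_def abs_less_iff)
    then show "ereal (g y) + u y < ereal c" by (cases "u y") auto
  qed (use e1 e2 in auto)
qed

lemma measure_cball_pos: "0 < r \<Longrightarrow> 0 < measure lborel (cball x r)"
  for x :: "'a::euclidean_space"
  using content_cball_pos[of r x] by simp

lemma set_integral_const_compact:
  fixes K :: "'a::euclidean_space set"
  assumes "compact K"
  shows "set_integrable lborel K (\<lambda>_. c::real)" "(LINT x:K|lborel. c) = c * measure lborel K"
proof -
  have *: "K \<in> sets lborel" "emeasure lborel K < \<infinity>"
    using assms emeasure_compact_finite[of K] by (auto simp: compact_imp_closed)
  then show "set_integrable lborel K (\<lambda>_. c)"
    unfolding set_integrable_def by auto
  show "(LINT x:K|lborel. c) = c * measure lborel K"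
    using * by (simp add: set_lebesgue_integral_def mult.commute)
qed

lemma lborel_set_integral_mono_AE:
  fixes u v :: "'a::euclidean_space \<Rightarrow> real"
  assumes "set_integrable lborel K u" "set_integrable lborel K v"
    and "AE x in lborel. x \<in> K \<longrightarrow> u x \<le> v x"
  shows "(LINT x:K|lborel. u x) \<le> (LINT x:K|lborel. v x)"
  using assms unfolding set_lebesgue_integral_def set_integrable_def
  by (intro integral_mono_AE) (auto simp: indicator_def elim!: eventually_mono)

lemma proper_sbh_mean_real:
  assumes "open D" "connected D" "proper_sbh D u" "0 < r" "cball x r \<subseteq> D" "u x = ereal a"
  shows "measure lborel (cball x r) * a \<le> (LINT y:cball x r|lborel. rval D u y)"
  using proper_sbh_mean[OF assms(1-5)] assms(6) by simp

text \<open>The arrangement of the terms matters: the left side has the sub-mean value property, the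
  right side is upper semicontinuous. A violation at \<open>x\<close> leaves room for a constant
  \<open>c\<close> that exceeds the right side on a whole ball about \<open>x\<close> but lies below
  the left side at its centre.\<close>

lemma AE_le_imp_le:
  assumes D: "open D" "connected D" and u: "proper_sbh D u" and v: "proper_sbh D v"
    and g: "continuous_on D g" and w: "usc_on D w"
    and ae: "AE x in lborel. x \<in> D \<longrightarrow> u x + v x \<le> ereal (g x) + w x"
    and x: "x \<in> D"
  shows "u x + v x \<le> ereal (g x) + w x"
proof (rule ccontr)
  assume "\<not> u x + v x \<le> ereal (g x) + w x"
  then obtain c where c: "ereal (g x) + w x < ereal c" "ereal c < u x + v x"
    using ereal_dense2 by (metis not_le)
  obtain e where e: "0 < e" "cball x e \<subseteq> D" "\<And>y. y \<in> cball x e \<Longrightarrow> ereal (g y) + w y < ereal c"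
    using usc_add_continuous_less[OF D(1) g w x c(1)] by blast
  have "u x < \<infinity>" "v x < \<infinity>" using u v x sbhD(2) unfolding proper_sbh_def by blast+
  then obtain a b where ab: "u x = ereal a" "v x = ereal b"
    using c(2) by (cases "u x"; cases "v x") auto
  let ?B = "cball x e"
  note iu = proper_sbh_on_compact(1)[OF D u compact_cball e(2)]
  note iv = proper_sbh_on_compact(1)[OF D v compact_cball e(2)]
  have "measure lborel ?B * (a + b) \<le> (LINT y:?B|lborel. rval D u y) + (LINT y:?B|lborel. rval D v y)"
    using proper_sbh_mean_real[OF D u e(1,2) ab(1)] proper_sbh_mean_real[OF D v e(1,2) ab(2)]
    by (simp add: distrib_left)
  also have "\<dots> = (LINT y:?B|lborel. rval D u y + rval D v y)"
    using iu iv by (simp add: set_integral_add)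
  also have "\<dots> \<le> (LINT y:?B|lborel. c)"
  proof (rule lborel_set_integral_mono_AE)
    show "AE y in lborel. y \<in> ?B \<longrightarrow> rval D u y + rval D v y \<le> c"
      using ae proper_sbh_AE[OF D u] proper_sbh_AE[OF D v]
    proof eventually_elim
      case (elim y)
      show ?case
      proof
        assume y: "y \<in> ?B"
        then have yD: "y \<in> D" using e(2) by blast
        have "u y + v y < ereal c" using elim(1) yD e(3)[OF y] by (meson le_less_trans)
        then show "rval D u y + rval D v y \<le> c" using elim(2,3) yD
          by (metis less_eq_ereal_def ereal_less_eq(3) plus_ereal.simps(1))
      qed
    qed
  qed (use iu iv set_integral_const_compact(1)[OF compact_cball] in \<open>auto intro: set_integral_add\<close>)
  also have "\<dots> = measure lborel ?B * c"
    by (simp add: set_integral_const_compact(2) mult.commute)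
  finally have "a + b \<le> c" using measure_cball_pos[OF e(1), of x] by simp
  then show False using c(2) ab by simp
qed

section \<open>Supports of Borel measures\<close>

lemma AE_in_msupp:
  fixes \<mu> :: "'a::euclidean_space measure"
  assumes "sets \<mu> = sets borel" shows "AE x in \<mu>. x \<in> msupp \<mu>"
proof -
  define F where "F = {ball x e | x e. 0 < e \<and> emeasure \<mu> (ball x e) = 0}"
  \<comment> \<open>The complement of the support is a union of null balls; by Lindelof countably
    many of them already cover it, so it is a null set.\<close>
  obtain F' where F': "F' \<subseteq> F" "countable F'" "\<Union>F' = \<Union>F"
    using Lindelof[of F] unfolding F_def by blast
  have "(\<Union>A\<in>F'. A) \<in> null_sets \<mu>"
  proof (rule null_sets_UN')
    fix A assume "A \<in> F'"
    then obtain x e where "A = ball x e" "emeasure \<mu> A = 0" using F'(1) unfolding F_def by blast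
    then show "A \<in> null_sets \<mu>" using assms by (simp add: null_sets_def)
  qed (fact F'(2))
  then have "\<Union>F \<in> null_sets \<mu>" using F'(3) by simp
  then have "AE x in \<mu>. x \<notin> \<Union>F" by (rule AE_not_in)
  then show ?thesis
  proof (rule eventually_mono)
    fix x assume x: "x \<notin> \<Union>F"
    have "emeasure \<mu> (ball x e) \<noteq> 0" if "0 < e" for e
    proof
      assume "emeasure \<mu> (ball x e) = 0"
      then have "ball x e \<in> F" using that unfolding F_def by blast
      then show False using x that by (meson UnionI centre_in_ball)
    qed
    then show "x \<in> msupp \<mu>" by (simp add: msupp_def)
  qed
qed

lemma closed_msupp:
  fixes \<mu> :: "'a::euclidean_space measure"
  assumes "sets \<mu> = sets borel" shows "closed (msupp \<mu>)"
  unfolding closed_def open_contains_ball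
proof
  fix x assume "x \<in> - msupp \<mu>"
  then obtain e where e: "0 < e" "emeasure \<mu> (ball x e) = 0" by (auto simp: msupp_def)
  have "y \<in> - msupp \<mu>" if y: "y \<in> ball x e" for y
  proof -
    have "ball y (e - dist x y) \<subseteq> ball x e" by (simp add: ball_subset_ball_iff dist_commute)
    then have "emeasure \<mu> (ball y (e - dist x y)) \<le> 0"
      using emeasure_mono[of _ "ball x e" \<mu>] e(2) assms by simp
    then show ?thesis using y by (auto simp: msupp_def intro!: exI[of _ "e - dist x y"])
  qed
  then show "\<exists>e>0. ball x e \<subseteq> - msupp \<mu>" using e(1) by blast
qed

lemma continuous_on_zero_extension_measurable:
  fixes g :: "'a::euclidean_space \<Rightarrow> real"
  assumes "open D" "continuous_on D g"
  shows "(\<lambda>x. if x \<in> D then g x else 0) \<in> borel_measurable borel"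
  using assms by (intro borel_measurable_continuous_on_if) auto

section \<open>The dual measures\<close>

locale sbh_cone =
  fixes D :: "'a::euclidean_space set" and H :: "('a \<Rightarrow> ereal) set" and x0 :: 'a and r :: real
  assumes D_open: "open D" and D_conn: "connected D"
    and r_pos: "r > 0" and ball_sub: "cball x0 r \<subseteq> D"
    and H_sbh: "\<forall>h\<in>H. sbh D h"
    and H_add: "\<forall>u\<in>H. \<forall>v\<in>H. memD D (\<lambda>x. u x + v x) H"
    and H_smult: "\<forall>u\<in>H. \<forall>c::real. c \<ge> 0 \<longrightarrow> memD D (\<lambda>x. ereal c * u x) H"
    and H_limsup: "\<forall>hs. (\<forall>k. hs k \<in> H) \<longrightarrow> loc_unif_bdd_above D hs \<longrightarrow>
                      memD D (usc_reg D (\<lambda>x. limsup (\<lambda>k. hs k x))) H"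
begin

lemma properI: "h \<in> H \<Longrightarrow> \<exists>x\<in>D. h x \<noteq> -\<infinity> \<Longrightarrow> proper_sbh D h"
  using H_sbh by (simp add: proper_sbh_def)

lemma combination:
  assumes u: "u \<in> H" "proper_sbh D u" and v: "v \<in> H" "proper_sbh D v" and ab: "0 \<le> a" "0 \<le> b"
  obtains w where "w \<in> H" "proper_sbh D w"
    "AE x in lborel. x \<in> D \<longrightarrow> rval D w x = a * rval D u x + b * rval D v x"
proof -
  obtain u' where u': "u' \<in> H" "\<forall>x\<in>D. u' x = ereal a * u x"
    using H_smult u(1) ab unfolding memD_def by blast
  obtain v' where v': "v' \<in> H" "\<forall>x\<in>D. v' x = ereal b * v x"
    using H_smult v(1) ab unfolding memD_def by blast
  obtain w where w: "w \<in> H" "\<forall>x\<in>D. w x = u' x + v' x"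
    using H_add u'(1) v'(1) unfolding memD_def by blast
  have ae: "AE x in lborel. x \<in> D \<longrightarrow> w x = ereal (a * rval D u x + b * rval D v x)"
    using proper_sbh_AE[OF D_open D_conn u(2)] proper_sbh_AE[OF D_open D_conn v(2)]
    by eventually_elim (auto simp: w u' v')
  \<comment> \<open>Properness is not automatic for a sum, since the two sets of value minus
    infinity might cover \<open>D\<close>. As both are null sets, the ball contains a point where
    \<open>w\<close> is finite.\<close>
  then have "AE x in lborel. x \<in> ball x0 r \<longrightarrow> w x \<noteq> -\<infinity>"
    using ball_sub ball_subset_cball[of x0 r] by (elim eventually_mono) force
  then obtain x where "x \<in> ball x0 r" "w x \<noteq> -\<infinity>" by (rule AE_ball_point[OF _ r_pos])
  then have "proper_sbh D w" using w(1) ball_sub ball_subset_cball by (intro properI) blast+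
  moreover have "AE x in lborel. x \<in> D \<longrightarrow> rval D w x = a * rval D u x + b * rval D v x"
    using ae by (elim eventually_mono) (simp add: rval_def)
  ultimately show ?thesis using w(1) that by blast
qed

lemma JH_D:
  assumes "\<mu> \<in> JH D H x0 r"
  shows "finite_measure \<mu>" "sets \<mu> = sets borel" "compact (msupp \<mu>)" "msupp \<mu> \<subseteq> D"
    "h \<in> H \<Longrightarrow> eint lebesgue (cball x0 r) h \<le> eint \<mu> D h"
  using assms unfolding JH_def Meas0plus_def by (auto intro!: finite_measureI)

text \<open>The inequality that defines \<open>JH\<close> bounds the integral of \<open>h\<close>
  against \<open>\<mu>\<close> from below by the integral of \<open>h\<close> over the ball, which
  is finite; from above it is bounded by the compactness of the support. This is the finiteness that
  gives meaning to the integral of \<open>s\<close>.\<close>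

lemma JH_proper:
  assumes \<mu>: "\<mu> \<in> JH D H x0 r" and h: "h \<in> H" "proper_sbh D h"
  shows "integrable \<mu> (rval D h)" "AE x in \<mu>. x \<in> D \<and> h x = ereal (rval D h x)"
    "eint \<mu> D h = ereal (\<integral>x. rval D h x \<partial>\<mu>)"
proof -
  have "ereal (LINT x:cball x0 r|lborel. rval D h x) \<le> eint \<mu> D h"
    using JH_D(5)[OF \<mu> h(1)] proper_sbh_eint[OF D_open D_conn h(2) compact_cball ball_sub] by simp
  then have fin: "eint \<mu> D h \<noteq> -\<infinity>" by auto
  have s: "sbh D h" using h by (simp add: proper_sbh_def)
  show "integrable \<mu> (rval D h)" "AE x in \<mu>. x \<in> D \<and> h x = ereal (rval D h x)"
    "eint \<mu> D h = ereal (\<integral>x. rval D h x \<partial>\<mu>)"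
    using eint_finite_imp_integrable[OF D_open sbhD(1,2)[OF s] JH_D(1-4)[OF \<mu>]
        AE_in_msupp[OF JH_D(2)[OF \<mu>]] fin] by auto
qed

lemma JH_continuous:
  assumes \<mu>: "\<mu> \<in> JH D H x0 r" and g: "continuous_on D g"
  shows "integrable \<mu> (\<lambda>x. if x \<in> D then g x else 0)"
    "eint \<mu> D (\<lambda>x. ereal (g x)) = ereal (\<integral>x. (if x \<in> D then g x else 0) \<partial>\<mu>)"
proof -
  interpret finite_measure \<mu> by (rule JH_D(1)[OF \<mu>])
  have "compact (g ` msupp \<mu>)"
    using JH_D(3,4)[OF \<mu>] g by (intro compact_continuous_image) (auto intro: continuous_on_subset)
  then obtain C where C: "\<forall>x\<in>msupp \<mu>. \<bar>g x\<bar> \<le> C"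
    using compact_imp_bounded bounded_iff by (metis imageI real_norm_def)
  have ae: "AE x in \<mu>. x \<in> msupp \<mu>" by (rule AE_in_msupp[OF JH_D(2)[OF \<mu>]])
  show i: "integrable \<mu> (\<lambda>x. if x \<in> D then g x else 0)"
  proof (rule integrable_const_bound[where B = C])
    show "AE x in \<mu>. norm (if x \<in> D then g x else 0) \<le> C"
      using ae by eventually_elim (use C JH_D(4)[OF \<mu>] in auto)
    show "(\<lambda>x. if x \<in> D then g x else 0) \<in> borel_measurable \<mu>"
      using continuous_on_zero_extension_measurable[OF D_open g] JH_D(2)[OF \<mu>] measurable_cong_sets
      by blast
  qed
  show "eint \<mu> D (\<lambda>x. ereal (g x)) = ereal (\<integral>x. (if x \<in> D then g x else 0) \<partial>\<mu>)"
    by (rule eint_eq_integral[OF _ i], use ae in eventually_elim) (use JH_D(4)[OF \<mu>] in auto)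
qed

section \<open>Minorants lie below the dual bound\<close>

lemma minorant_le_dual:
  assumes h: "h \<in> H" "proper_sbh D h" and h1: "h1 \<in> H" "proper_sbh D h1"
    and h2: "h2 \<in> H" "proper_sbh D h2" and g: "continuous_on D g"
    and ae: "AE x in lborel. x \<in> D \<longrightarrow> h x \<le> ereal (g x) + h1 x - h2 x"
    and \<mu>: "\<mu> \<in> JH D H x0 r"
  shows "eint lebesgue (cball x0 r) h \<le> eint \<mu> D (\<lambda>x. ereal (g x)) + eint \<mu> D h1 - eint \<mu> D h2"
proof -
  have "AE x in lborel. x \<in> D \<longrightarrow> h x + h2 x \<le> ereal (g x) + h1 x"
    using ae proper_sbh_AE[OF D_open D_conn h2(2)] proper_sbh_AE[OF D_open D_conn h1(2)]
  proof eventually_elim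
    case (elim x)
    show ?case
    proof
      assume x: "x \<in> D"
      obtain a b where "h1 x = ereal a" "h2 x = ereal b" using elim x by blast
      then show "h x + h2 x \<le> ereal (g x) + h1 x" using elim(1) x by (cases "h x") auto
    qed
  qed
  \<comment> \<open>A measure in \<open>JH\<close> may charge Lebesgue null sets, so the inequality
    is needed at every point of \<open>D\<close> before it can be integrated.\<close>
  then have le: "h x + h2 x \<le> ereal (g x) + h1 x" if "x \<in> D" for x
    using AE_le_imp_le[OF D_open D_conn h(2) h2(2) g _ _ that] h1(2) sbhD(1)
    unfolding proper_sbh_def by blast
  note i = JH_proper(1)[OF \<mu> h] JH_proper(1)[OF \<mu> h1] JH_proper(1)[OF \<mu> h2] JH_continuous(1)[OF \<mu> g]
  have "(\<integral>x. rval D h x + rval D h2 x \<partial>\<mu>) \<le> (\<integral>x. (if x \<in> D then g x else 0) + rval D h1 x \<partial>\<mu>)"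
  proof (rule integral_mono_AE)
    show "AE x in \<mu>. rval D h x + rval D h2 x \<le> (if x \<in> D then g x else 0) + rval D h1 x"
      using JH_proper(2)[OF \<mu> h] JH_proper(2)[OF \<mu> h1] JH_proper(2)[OF \<mu> h2]
    proof eventually_elim
      case (elim x)
      then have "ereal (rval D h x + rval D h2 x) \<le> ereal (g x + rval D h1 x)"
        using le[of x] by (metis plus_ereal.simps(1))
      then show ?case using elim by simp
    qed
  qed (use i in auto)
  then have "(\<integral>x. rval D h x \<partial>\<mu>) \<le> (\<integral>x. (if x \<in> D then g x else 0) \<partial>\<mu>)
      + (\<integral>x. rval D h1 x \<partial>\<mu>) - (\<integral>x. rval D h2 x \<partial>\<mu>)"
    using i by simp
  then have "eint \<mu> D h \<le> eint \<mu> D (\<lambda>x. ereal (g x)) + eint \<mu> D h1 - eint \<mu> D h2"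
    by (simp add: JH_proper(3)[OF \<mu> h] JH_proper(3)[OF \<mu> h1] JH_proper(3)[OF \<mu> h2] JH_continuous(2)[OF \<mu> g])
  then show ?thesis using JH_D(5)[OF \<mu> h(1)] by simp
qed



section \<open>Dual measures with a density\<close>

lemma eint_improper:
  assumes "\<forall>x\<in>D. h x = -\<infinity>" shows "eint lebesgue (cball x0 r) h = -\<infinity>"
proof -
  have h: "h x = -\<infinity>" if "x \<in> cball x0 r" for x using assms ball_sub that by blast
  have "(\<integral>\<^sup>+x. e2ennreal (max 0 (h x)) * indicator (cball x0 r) x \<partial>lebesgue) = (\<integral>\<^sup>+(x::'a). 0 \<partial>lebesgue)"
    by (intro nn_integral_cong) (auto simp: indicator_def h zero_ennreal_def[symmetric])
  moreover have "(\<integral>\<^sup>+x. e2ennreal (max 0 (- h x)) * indicator (cball x0 r) x \<partial>lebesgue)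
      = (\<integral>\<^sup>+x. \<infinity> * indicator (cball x0 r) x \<partial>lebesgue)"
    by (intro nn_integral_cong) (auto simp: indicator_def h max_def)
  moreover have "\<dots> = \<infinity> * emeasure lebesgue (cball x0 r)"
    by (intro nn_integral_cmult_indicator) simp
  moreover have "emeasure lebesgue (cball x0 r) \<noteq> 0"
    using content_cball_pos[OF r_pos, of x0] by (auto simp: measure_def)
  ultimately show ?thesis unfolding eint_def by (simp add: ennreal_top_mult zero_ennreal.rep_eq)
qed

text \<open>The variational problem tests \<open>\<rho>\<close> only against proper functions. For a
  member of \<open>H\<close> that is minus infinity throughout \<open>D\<close>, the inequality
  holds because its left side is minus infinity.\<close>

lemma density_in_JH:
  assumes K: "compact K" "K \<subseteq> D"
    and \<rho>: "integrable (lborel_in K) \<rho>" "\<And>x. 0 \<le> \<rho> x"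
    and jensen: "\<And>h. h \<in> H \<Longrightarrow> proper_sbh D h \<Longrightarrow> integrable (lborel_in K) (\<lambda>x. \<rho> x * rval D h x) \<and>
      (LINT x:cball x0 r|lborel. rval D h x) \<le> (\<integral>x. \<rho> x * rval D h x \<partial>lborel_in K)"
  shows "density (lborel_in K) (\<lambda>x. ennreal (\<rho> x)) \<in> JH D H x0 r"
proof -
  define \<nu> where "\<nu> = density (lborel_in K) (\<lambda>x. ennreal (\<rho> x))"
  have sets: "sets \<nu> = sets borel" by (simp add: \<nu>_def)
  have Kb: "K \<in> sets borel" using K(1) by (simp add: compact_imp_closed)
  have [measurable]: "\<rho> \<in> borel_measurable borel"
    using borel_measurable_integrable[OF \<rho>(1)] by simp
  have "emeasure \<nu> (space \<nu>) = (\<integral>\<^sup>+x. ennreal (\<rho> x) \<partial>lborel_in K)"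
    unfolding \<nu>_def by (simp add: emeasure_density cong: nn_integral_cong)
  also have "\<dots> < \<infinity>" using \<rho> by (subst nn_integral_eq_integral) auto
  finally have fin: "emeasure \<nu> (space \<nu>) < \<infinity>" .
  have aeK: "AE x in \<nu>. x \<in> K"
    unfolding \<nu>_def by (subst AE_density) (auto simp: AE_lborel_in[OF Kb])
  have msK: "msupp \<nu> \<subseteq> K"
  proof
    fix x assume x: "x \<in> msupp \<nu>"
    show "x \<in> K"
    proof (rule ccontr)
      assume "x \<notin> K"
      moreover have "open (- K)" using K(1) compact_imp_closed by blast
      ultimately obtain e where e: "0 < e" "ball x e \<subseteq> - K" using open_contains_ball by blast
      have "AE y in \<nu>. y \<notin> ball x e" using aeK by (rule eventually_mono) (use e(2) in blast)
      then have "ball x e \<in> null_sets \<nu>" using AE_iff_null_sets[of "ball x e" \<nu>] sets by simp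
      then show False using x e(1) by (auto simp: msupp_def)
    qed
  qed
  then have "compact (msupp \<nu>)"
    using compact_Int_closed[OF K(1) closed_msupp[OF sets]] by (simp add: inf.absorb2)
  then have m0: "Meas0plus D \<nu>" unfolding Meas0plus_def using sets fin msK K(2) by auto
  have "eint lebesgue (cball x0 r) h \<le> eint \<nu> D h" if h: "h \<in> H" for h
  proof (cases "\<exists>x\<in>D. h x \<noteq> -\<infinity>")
    case False
    then show ?thesis using eint_improper[of h] by simp
  next
    case True
    then have p: "proper_sbh D h" using h properI by blast
    then have s: "sbh D h" by (simp add: proper_sbh_def)
    have m: "rval D h \<in> borel_measurable (lborel_in K)"
      using rval_measurable[OF D_open sbhD(1,2)[OF s]] by simp
    note j = jensen[OF h p]
    have i: "integrable \<nu> (rval D h)"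
      unfolding \<nu>_def using j m \<rho>(2) by (subst integrable_density) auto
    have "(\<integral>x. rval D h x \<partial>\<nu>) = (\<integral>x. \<rho> x * rval D h x \<partial>lborel_in K)"
      unfolding \<nu>_def using m \<rho>(2) by (subst integral_density) auto
    moreover have "eint \<nu> D h = ereal (\<integral>x. rval D h x \<partial>\<nu>)"
    proof (rule eint_eq_integral[OF _ i])
      have "AE x in lborel_in K. x \<in> D \<and> h x = ereal (rval D h x)"
        unfolding AE_lborel_in[OF Kb] using proper_sbh_AE[OF D_open D_conn p]
        by (rule eventually_mono) (use K(2) in blast)
      then show "AE x in \<nu>. x \<in> D \<and> h x = ereal (rval D h x)"
        unfolding \<nu>_def by (subst AE_density) (auto elim: eventually_mono)
    qed
    ultimately show ?thesis
      using j proper_sbh_eint[OF D_open D_conn p compact_cball ball_sub] by simp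
  qed
  then show ?thesis unfolding JH_def \<nu>_def[symmetric] using m0 by blast
qed

text \<open>The error is measured only on \<open>K\<close> and only against the truncated majorant;
  both restrictions vanish when \<open>K\<close> and \<open>m\<close> grow. \<open>K\<close>
  contains the ball because \<open>mass\<close> integrates over the ball with respect to
  \<open>lborel_in K\<close>.\<close>

lemma approximate_minorant:
  fixes g :: "'a \<Rightarrow> real"
  defines "g' \<equiv> \<lambda>x. if x \<in> D then g x else 0"
  assumes h1: "h1 \<in> H" "proper_sbh D h1" and h2: "h2 \<in> H" "proper_sbh D h2"
    and g: "continuous_on D g"
    and c: "\<And>\<mu>. \<mu> \<in> JH D H x0 r \<Longrightarrow>
      ereal c \<le> eint \<mu> D (\<lambda>x. ereal (g x)) + eint \<mu> D h1 - eint \<mu> D h2"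
    and K: "compact K" "K \<subseteq> D" "cball x0 r \<subseteq> K" and e: "0 < e"
  obtains h where "h \<in> H" "proper_sbh D h" "c - e \<le> (LINT x:cball x0 r|lborel. rval D h x)"
    "set_integrable lborel K (\<lambda>x. max 0 (rval D h x + rval D h2 x - max (g' x + rval D h1 x) (- real m)))"
    "(LINT x:K|lborel. max 0 (rval D h x + rval D h2 x - max (g' x + rval D h1 x) (- real m))) \<le> e"
proof -
  define M where "M = lborel_in K"
  define Hs where "Hs = {rval D h | h. h \<in> H \<and> proper_sbh D h}"
  define q where "q = (\<lambda>x. rval D h2 x - max (g' x + rval D h1 x) (- real m))"
  have Kb: "K \<in> sets borel" using K(1) by (simp add: compact_imp_closed)
  have meas: "rval D h \<in> borel_measurable borel" if "proper_sbh D h" for h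
    using rval_measurable[OF D_open] sbhD(1,2) that unfolding proper_sbh_def by blast
  have int: "integrable M (rval D h)" if "proper_sbh D h" for h
    unfolding M_def using integrable_lborel_in(1)[OF Kb meas[OF that]]
      proper_sbh_on_compact(1)[OF D_open D_conn that K(1,2)] by blast
  interpret fm: finite_measure M unfolding M_def by (rule finite_measure_lborel_in[OF K(1)])
  have aeK: "AE x in M. x \<in> K" unfolding M_def by (simp add: AE_lborel_in[OF Kb])
  have gm: "g' \<in> borel_measurable borel"
    unfolding g'_def by (rule continuous_on_zero_extension_measurable[OF D_open g])
  have "compact (g ` K)" using K g by (intro compact_continuous_image) (auto intro: continuous_on_subset)
  then obtain Cg where Cg: "\<forall>x\<in>K. \<bar>g x\<bar> \<le> Cg"
    using compact_imp_bounded bounded_iff by (metis imageI real_norm_def)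
  have gi: "integrable M g'"
  proof (rule fm.integrable_const_bound[where B = Cg])
    show "AE x in M. norm (g' x) \<le> Cg"
      using aeK by (rule eventually_mono) (use Cg K(2) in \<open>auto simp: g'_def\<close>)
  qed (use gm in \<open>simp add: M_def\<close>)
  interpret penalized_cone M Hs "cball x0 r" q
  proof
    show "cball x0 r \<in> sets M" by (simp add: M_def)
    show "integrable M u" if "u \<in> Hs" for u using that int unfolding Hs_def by blast
    show "\<exists>C. AE x in M. u x \<le> C" if u: "u \<in> Hs" for u
    proof -
      obtain h where h: "u = rval D h" "proper_sbh D h" using u by (auto simp: Hs_def)
      obtain C where "0 \<le> C" "\<And>x. x \<in> K \<Longrightarrow> h x \<le> ereal C" and C: "\<And>x. x \<in> K \<Longrightarrow> rval D h x \<le> C"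
        by (rule proper_sbh_bounded[OF D_open h(2) K(1,2)]) (rule that)
      have "AE x in M. u x \<le> C" unfolding h(1) using aeK by (rule eventually_mono) (rule C)
      then show ?thesis by blast
    qed
    \<comment> \<open>Equality can be expected only a.e.: \<open>rval\<close> is 0 where a function
      is minus infinity, and there it is not additive.\<close>
    show "\<exists>w\<in>Hs. AE x in M. w x = a * u x + b * v x"
      if uv: "u \<in> Hs" "v \<in> Hs" and ab: "0 \<le> a" "0 \<le> b" for u v a b
    proof -
      obtain hu hv where hu: "u = rval D hu" "hu \<in> H" "proper_sbh D hu"
        and hv: "v = rval D hv" "hv \<in> H" "proper_sbh D hv" using uv by (auto simp: Hs_def)
      obtain w where w: "w \<in> H" "proper_sbh D w"
        "AE x in lborel. x \<in> D \<longrightarrow> rval D w x = a * rval D hu x + b * rval D hv x"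
        by (rule combination[OF hu(2,3) hv(2,3) ab])
      have "AE x in M. rval D w x = a * u x + b * v x"
        unfolding M_def AE_lborel_in[OF Kb] hu(1) hv(1) using w(3)
        by (rule eventually_mono) (use K(2) in blast)
      then show ?thesis using w(1,2) unfolding Hs_def by blast
    qed
    show "Hs \<noteq> {}" using h1 unfolding Hs_def by blast
    show "integrable M q" unfolding q_def using gi int[OF h1(2)] int[OF h2(2)] by auto
    obtain C where "0 \<le> C" "\<And>x. x \<in> K \<Longrightarrow> h2 x \<le> ereal C" and C: "\<And>x. x \<in> K \<Longrightarrow> rval D h2 x \<le> C"
      by (rule proper_sbh_bounded[OF D_open h2(2) K(1,2)]) (rule that)
    have "AE x in M. q x \<le> C + real m"
      using aeK
    proof eventually_elim
      case (elim x)
      show ?case using C[OF elim] max.cobounded2[of "- real m" "g' x + rval D h1 x"]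
        unfolding q_def by linarith
    qed
    then show "\<exists>C. AE x in M. q x \<le> C" by blast
  qed
  have massB: "mass (rval D h) = (LINT x:cball x0 r|lborel. rval D h x)" if "proper_sbh D h" for h
  proof -
    have "mass (rval D h) = (LINT x:K|lborel. indicator (cball x0 r) x * rval D h x)"
      unfolding mass_def unfolding M_def
      using meas[OF that] 
      by (intro integrable_lborel_in(2)[OF Kb] borel_measurable_times borel_measurable_indicator) auto
    also have "\<dots> = (LINT x:cball x0 r|lborel. rval D h x)"
      unfolding set_lebesgue_integral_def
      using K(3) by (intro Bochner_Integration.integral_cong) (auto simp: indicator_def)
    finally show ?thesis .
  qed
  have dual: "c \<le> - (\<integral>x. \<rho> x * q x \<partial>M)"
    if \<rho>: "integrable M \<rho>" "\<And>x. 0 \<le> \<rho> x"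
      and j: "\<And>v. v \<in> Hs \<Longrightarrow> integrable M (\<lambda>x. \<rho> x * v x) \<and> mass v \<le> (\<integral>x. \<rho> x * v x \<partial>M)"
      and \<rho>q: "integrable M (\<lambda>x. \<rho> x * q x)" for \<rho>
  proof -
    define \<nu> where "\<nu> = density M (\<lambda>x. ennreal (\<rho> x))"
    have \<nu>: "\<nu> \<in> JH D H x0 r"
      unfolding \<nu>_def M_def
    proof (rule density_in_JH[OF K(1,2)])
      fix h assume h: "h \<in> H" "proper_sbh D h"
      then have "rval D h \<in> Hs" by (auto simp: Hs_def)
      then show "integrable (lborel_in K) (\<lambda>x. \<rho> x * rval D h x) \<and>
        (LINT x:cball x0 r|lborel. rval D h x) \<le> (\<integral>x. \<rho> x * rval D h x \<partial>lborel_in K)"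
        using j massB[OF h(2)] unfolding M_def by metis
    qed (use \<rho> in \<open>auto simp: M_def\<close>)
    have im: "integral\<^sup>L \<nu> v = (\<integral>x. \<rho> x * v x \<partial>M)" "integrable \<nu> v \<longleftrightarrow> integrable M (\<lambda>x. \<rho> x * v x)"
      if "v \<in> borel_measurable borel" for v
    proof -
      have vM: "v \<in> borel_measurable M" "\<rho> \<in> borel_measurable M" "AE x in M. 0 \<le> \<rho> x"
        using that \<rho> by (auto simp: M_def)
      show "integral\<^sup>L \<nu> v = (\<integral>x. \<rho> x * v x \<partial>M)"
        unfolding \<nu>_def using integral_density[OF vM] by simp
      show "integrable \<nu> v \<longleftrightarrow> integrable M (\<lambda>x. \<rho> x * v x)"
        unfolding \<nu>_def using integrable_density[OF vM] by simp
    qed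
    note i = JH_proper(1)[OF \<nu> h1] JH_proper(1)[OF \<nu> h2] JH_continuous(1)[OF \<nu> g, folded g'_def]
    have "c \<le> (\<integral>x. g' x \<partial>\<nu>) + (\<integral>x. rval D h1 x \<partial>\<nu>) - (\<integral>x. rval D h2 x \<partial>\<nu>)"
      using c[OF \<nu>] unfolding JH_proper(3)[OF \<nu> h1] JH_proper(3)[OF \<nu> h2] JH_continuous(2)[OF \<nu> g, folded g'_def]
      by simp
    also have "\<dots> = (\<integral>x. g' x + rval D h1 x - rval D h2 x \<partial>\<nu>)" using i by simp
    \<comment> \<open>The truncation works in favour of the bound: \<open>- q\<close> contains a
      maximum, so it dominates the function \<open>s\<close> for which \<open>c\<close> is a lower
      bound.\<close>
    also have "\<dots> \<le> (\<integral>x. - q x \<partial>\<nu>)"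
    proof (rule integral_mono)
      have "q \<in> borel_measurable borel" using q_meas by (simp add: M_def)
      then show "integrable \<nu> (\<lambda>x. - q x)" using im(2) \<rho>q by auto
    qed (use i in \<open>auto simp: q_def\<close>)
    also have "\<dots> = - (\<integral>x. \<rho> x * q x \<partial>M)"
      using im(1)[of q] q_meas by (simp add: M_def)
    finally show ?thesis .
  qed
  obtain u where u: "u \<in> Hs" "c - e \<le> mass u" "(\<integral>x. excess u x \<partial>M) \<le> e"
    by (rule approximate_majorized[OF dual e])
  obtain h where h: "u = rval D h" "h \<in> H" "proper_sbh D h" using u(1) by (auto simp: Hs_def)
  have ex: "excess u = (\<lambda>x. max 0 (rval D h x + rval D h2 x - max (g' x + rval D h1 x) (- real m)))"
    by (rule ext, unfold excess_def, unfold h(1) q_def) (simp add: add_diff_eq)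
  have em: "excess u \<in> borel_measurable borel" using excess_meas[OF u(1)] by (simp add: M_def)
  show ?thesis
  proof (rule that[OF h(2,3)])
    show "c - e \<le> (LINT x:cball x0 r|lborel. rval D h x)" using u(2) massB[OF h(3)] h(1) by simp
    show "set_integrable lborel K (\<lambda>x. max 0 (rval D h x + rval D h2 x - max (g' x + rval D h1 x) (- real m)))"
      using integrable_excess[OF u(1)] integrable_lborel_in(1)[OF Kb em] unfolding ex M_def by simp
    show "(LINT x:K|lborel. max 0 (rval D h x + rval D h2 x - max (g' x + rval D h1 x) (- real m))) \<le> e"
      using u(3) integrable_lborel_in(2)[OF Kb em] unfolding ex M_def by simp
  qed
qed

end

section \<open>The regularized upper limit\<close>

lemma loc_unif_bdd_above_compact:
  assumes hs: "loc_unif_bdd_above D hs" and A: "compact A" "A \<subseteq> D"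
  obtains M :: real where "0 \<le> M" "\<forall>k. \<forall>x\<in>A. hs k x \<le> ereal M"
proof -
  have "\<forall>x\<in>A. \<exists>e>0. \<exists>C::real. \<forall>k. \<forall>y\<in>ball x e \<inter> D. hs k y \<le> ereal C"
    using hs A(2) unfolding loc_unif_bdd_above_def by blast
  then obtain e C where e: "\<forall>x\<in>A. 0 < e x"
    and C: "\<forall>x\<in>A. \<forall>k. \<forall>y\<in>ball x (e x) \<inter> D. hs k y \<le> ereal (C x :: real)"
    by metis
  have "A \<subseteq> (\<Union>x\<in>A. ball x (e x))" using e by force
  then obtain F where F: "F \<subseteq> A" "finite F" "A \<subseteq> (\<Union>x\<in>F. ball x (e x))"
    using compactE_image[OF A(1), of A "\<lambda>x. ball x (e x)"] by auto
  show ?thesis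
  proof (rule that[of "\<Sum>x\<in>F. \<bar>C x\<bar>"], goal_cases)
    case 2
    show ?case
    proof (intro allI ballI)
      fix k y assume y: "y \<in> A"
      then obtain x where x: "x \<in> F" "y \<in> ball x (e x)" using F(3) by blast
      have "x \<in> A" "y \<in> ball x (e x) \<inter> D" using x y F(1) A(2) by auto
      then have "hs k y \<le> ereal (C x)" using C by blast
      also have "C x \<le> (\<Sum>x\<in>F. \<bar>C x\<bar>)"
        using member_le_sum[of x F "\<lambda>x. \<bar>C x\<bar>"] x(1) F(2) by fastforce
      finally show "hs k y \<le> ereal (\<Sum>x\<in>F. \<bar>C x\<bar>)" by simp
    qed
  qed (simp add: sum_nonneg)
qed

lemma rval_le:
  assumes "u x \<le> ereal C" "0 \<le> C" shows "rval D u x \<le> C"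
  using assms by (cases "u x") (auto simp: rval_def)

lemma measure_cball_eq:
  fixes x :: "'a::euclidean_space"
  assumes "0 \<le> s"
  shows "measure lborel (cball x s) = unit_ball_vol (real DIM('a)) * s ^ DIM('a)"
  using content_cball[OF assms, of x] by simp

section \<open>The sequence of approximate minorants\<close>

locale minorant_sequence = sbh_cone D H x0 r
  for D :: "'a::euclidean_space set" and H x0 r +
  fixes g :: "'a \<Rightarrow> real" and h1 h2 :: "'a \<Rightarrow> ereal" and c :: real
    and K :: "nat \<Rightarrow> 'a set" and hs :: "nat \<Rightarrow> 'a \<Rightarrow> ereal"
  assumes g: "continuous_on D g" and h1: "proper_sbh D h1" and h2: "proper_sbh D h2"
    and K: "\<And>n. compact (K n)" "\<And>n. K n \<subseteq> D"
    and K_exh: "\<And>A. compact A \<Longrightarrow> A \<subseteq> D \<Longrightarrow> \<exists>N. \<forall>n\<ge>N. A \<subseteq> K n"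
    and hs: "\<And>n. hs n \<in> H" "\<And>n. proper_sbh D (hs n)"
    and hs_mass: "\<And>n. c - 1 / real (Suc n) \<le> (LINT x:cball x0 r|lborel. rval D (hs n) x)"
    and hs_int: "\<And>n. set_integrable lborel (K n) (\<lambda>x. max 0 (rval D (hs n) x + rval D h2 x
          - max ((if x \<in> D then g x else 0) + rval D h1 x) (- real n)))"
    and hs_excess: "\<And>n. (LINT x:K n|lborel. max 0 (rval D (hs n) x + rval D h2 x
          - max ((if x \<in> D then g x else 0) + rval D h1 x) (- real n))) \<le> 1 / real (Suc n)"
begin

lemmas DD = D_open D_conn

text \<open>A.e. on \<open>A\<close>, \<open>hs n\<close> is at most \<open>b - h2\<close> plus its
  excess, and the excess contributes at most \<open>1 / real (Suc n)\<close>. The condition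
  \<open>- real n \<le> b\<close> puts the truncation level below \<open>b\<close>, so that
  \<open>b\<close> bounds the truncated majorant as well.\<close>

lemma integral_hs_le:
  assumes A: "compact A" "A \<subseteq> D" "A \<subseteq> K n" and b: "\<And>x. x \<in> A \<Longrightarrow> ereal (g x) + h1 x \<le> ereal b"
    and n: "- real n \<le> b"
  shows "(LINT x:A|lborel. rval D (hs n) x)
    \<le> b * measure lborel A - (LINT x:A|lborel. rval D h2 x) + 1 / real (Suc n)"
proof -
  define U where "U = (\<lambda>x. max 0 (rval D (hs n) x + rval D h2 x
          - max ((if x \<in> D then g x else 0) + rval D h1 x) (- real n)))"
  have Ab: "A \<in> sets lborel" using A(1) by (simp add: compact_imp_closed)
  have Ui: "set_integrable lborel (K n) U" using hs_int unfolding U_def .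
  have UiA: "set_integrable lborel A U" by (rule set_integrable_subset[OF Ui Ab A(3)])
  note i = proper_sbh_on_compact(1)[OF DD hs(2) A(1,2), of n]
    proper_sbh_on_compact(1)[OF DD h2 A(1,2)] UiA set_integral_const_compact(1)[OF A(1), of b]
  have "(LINT x:A|lborel. U x) \<le> (LINT x:K n|lborel. U x)"
    using UiA Ui A(3) unfolding set_lebesgue_integral_def set_integrable_def
    by (intro integral_mono) (auto simp: indicator_def U_def)
  then have U: "(LINT x:A|lborel. U x) \<le> 1 / real (Suc n)"
    using hs_excess[of n] unfolding U_def by linarith
  have "(LINT x:A|lborel. rval D (hs n) x) \<le> (LINT x:A|lborel. (b - rval D h2 x) + U x)"
  proof (rule lborel_set_integral_mono_AE)
    show "AE x in lborel. x \<in> A \<longrightarrow> rval D (hs n) x \<le> b - rval D h2 x + U x"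
      using proper_sbh_AE[OF DD h1]
    proof eventually_elim
      case (elim x)
      show ?case
      proof
        assume x: "x \<in> A"
        then have xD: "x \<in> D" using A(2) by blast
        have "g x + rval D h1 x \<le> b" using b[OF x] elim xD by simp
        then have "max ((if x \<in> D then g x else 0) + rval D h1 x) (- real n) \<le> b" using n xD by simp
        moreover have "rval D (hs n) x + rval D h2 x
            - max ((if x \<in> D then g x else 0) + rval D h1 x) (- real n) \<le> U x"
          unfolding U_def by (rule max.cobounded2)
        ultimately show "rval D (hs n) x \<le> b - rval D h2 x + U x" by linarith
      qed
    qed
    show "set_integrable lborel A (\<lambda>x. (b - rval D h2 x) + U x)"
      by (intro set_integral_add set_integral_diff i)
  qed (rule i)
  also have "\<dots> = (LINT x:A|lborel. b) - (LINT x:A|lborel. rval D h2 x) + (LINT x:A|lborel. U x)"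
    using i by (simp add: set_integral_add set_integral_diff)
  finally show ?thesis using U set_integral_const_compact(2)[OF A(1), of b] by linarith
qed

lemma hs_le_mean:
  assumes "0 < s" "cball y s \<subseteq> D" "(LINT x:cball y s|lborel. rval D (hs n) x) \<le> measure lborel (cball y s) * T"
  shows "hs n y \<le> ereal T"
proof -
  have "ereal (measure lborel (cball y s)) * hs n y \<le> ereal (measure lborel (cball y s) * T)"
    using proper_sbh_mean[OF DD hs(2) assms(1,2), of n] assms(3) by (meson ereal_less_eq(3) order_trans)
  then show ?thesis using measure_cball_pos[OF assms(1), of y] by (cases "hs n y") auto
qed

text \<open>Only integrals of \<open>hs n\<close> are under control. The sub-mean value inequality
  turns them into pointwise bounds, which is what the closure of \<open>H\<close> under upper limits
  asks for.\<close>

lemma hs_loc_bdd: "loc_unif_bdd_above D hs"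
  unfolding loc_unif_bdd_above_def
proof
  fix x assume x: "x \<in> D"
  obtain R where R: "0 < R" "cball x R \<subseteq> D" using D_open x open_contains_cball by blast
  define s where "s = R / 2"
  have s: "0 < s" using R by (simp add: s_def)
  have "compact (g ` cball x R)"
    using R g by (intro compact_continuous_image) (auto intro: continuous_on_subset)
  then obtain Cg where Cg: "\<forall>y\<in>cball x R. \<bar>g y\<bar> \<le> Cg"
    using compact_imp_bounded bounded_iff by (metis imageI real_norm_def)
  obtain C1 where C1: "0 \<le> C1" "\<And>y. y \<in> cball x R \<Longrightarrow> h1 y \<le> ereal C1"
      "\<And>y. y \<in> cball x R \<Longrightarrow> rval D h1 y \<le> C1"
    by (rule proper_sbh_bounded[OF D_open h1 compact_cball R(2)]) (rule that)
  define b where "b = \<bar>Cg\<bar> + C1"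
  have b: "ereal (g y) + h1 y \<le> ereal b" if "y \<in> cball x R" for y
  proof -
    have "g y \<le> \<bar>Cg\<bar>" using Cg that by fastforce
    then have "ereal (g y) + h1 y \<le> ereal \<bar>Cg\<bar> + ereal C1" using C1(2)[OF that] by (intro add_mono) auto
    then show ?thesis by (simp add: b_def)
  qed
  have b0: "0 \<le> b" using C1 by (simp add: b_def)
  obtain N where N: "\<forall>n\<ge>N. cball x R \<subseteq> K n" using K_exh[OF compact_cball R(2)] by blast
  define V where "V = unit_ball_vol (real DIM('a)) * s ^ DIM('a)"
  have V: "measure lborel (cball y s) = V" for y :: 'a
    unfolding V_def using s by (intro measure_cball_eq) simp
  have V0: "0 < V" using V measure_cball_pos[OF s] by metis
  \<comment> \<open>\<open>T\<close> bounds the integral of \<open>hs n\<close> over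
    \<open>cball y s\<close> for all \<open>y\<close> near \<open>x\<close> and all
    \<open>n \<ge> N\<close>. These balls share the volume \<open>V\<close> and lie in
    \<open>cball x R\<close>, so replacing \<open>- h2\<close> by its absolute value on the larger
    ball removes the dependence on \<open>y\<close>.\<close>
  define T where "T = b * V + (LINT y:cball x R|lborel. \<bar>rval D h2 y\<bar>) + 1"
  note ih2 = proper_sbh_on_compact(1)[OF DD h2 compact_cball R(2)]
  have large: "hs n y \<le> ereal (T / V)" if n: "n \<ge> N" and y: "y \<in> ball x s" for n y
  proof -
    have sub: "cball y s \<subseteq> cball x R"
      using y by (simp add: cball_subset_cball_iff s_def dist_commute)
    have 1: "(LINT z:cball y s|lborel. rval D (hs n) z)
        \<le> b * measure lborel (cball y s) - (LINT z:cball y s|lborel. rval D h2 z) + 1 / real (Suc n)"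
      using sub R(2) N n b b0 by (intro integral_hs_le) auto
    have 2: "- (LINT z:cball y s|lborel. rval D h2 z) \<le> (LINT z:cball x R|lborel. \<bar>rval D h2 z\<bar>)"
    proof -
      have i': "set_integrable lborel (cball y s) (rval D h2)"
        by (rule set_integrable_subset[OF ih2 _ sub]) simp
      have "(LINT z:cball y s|lborel. - rval D h2 z) \<le> (LINT z:cball x R|lborel. \<bar>rval D h2 z\<bar>)"
        unfolding set_lebesgue_integral_def
      proof (rule integral_mono)
        show "integrable lborel (\<lambda>z. indicator (cball y s) z *\<^sub>R - rval D h2 z)"
          using i' unfolding set_integrable_def by (simp flip: scaleR_minus_right)
        show "integrable lborel (\<lambda>z. indicator (cball x R) z *\<^sub>R \<bar>rval D h2 z\<bar>)"
          using set_integrable_abs[OF ih2] unfolding set_integrable_def .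
        show "indicator (cball y s) z *\<^sub>R - rval D h2 z \<le> indicator (cball x R) z *\<^sub>R \<bar>rval D h2 z\<bar>" for z
          using sub by (auto simp: indicator_def simp del: mem_cball)
      qed
      then show ?thesis unfolding set_lebesgue_integral_def by simp
    qed
    have "1 / real (Suc n) \<le> 1" by simp
    then have "(LINT z:cball y s|lborel. rval D (hs n) z) \<le> T"
      using 1 2 unfolding T_def V by linarith
    then show ?thesis using V0 sub R(2) by (intro hs_le_mean[OF s]) (auto simp: V)
  qed
  have "\<forall>n. \<exists>C\<ge>0. \<forall>y\<in>cball x R. hs n y \<le> ereal C"
  proof
    fix n
    show "\<exists>C\<ge>0. \<forall>y\<in>cball x R. hs n y \<le> ereal C"
      by (rule proper_sbh_bounded[OF D_open hs(2)[of n] compact_cball R(2)]) blast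
  qed
  then obtain C where C: "\<And>n. 0 \<le> C n" "\<And>n. \<forall>y\<in>cball x R. hs n y \<le> ereal (C n)" by metis
  define C' where "C' = \<bar>T / V\<bar> + (\<Sum>n<N. C n)"
  have "hs n y \<le> ereal C'" if y: "y \<in> ball x s" for n y
  proof (cases "n < N")
    case True
    have "y \<in> cball x R" using y s by (auto simp: s_def)
    then have "hs n y \<le> ereal (C n)" using C(2) by blast
    also have "C n \<le> C'"
    proof -
      have "C n \<le> (\<Sum>n<N. C n)" using True C(1) by (intro member_le_sum) auto
      then show ?thesis unfolding C'_def by linarith
    qed
    finally show ?thesis by simp
  next
    case False
    then have "hs n y \<le> ereal (T / V)" using large y by simp
    also have "T / V \<le> C'"
    proof -
      have "0 \<le> (\<Sum>n<N. C n)" using C(1) by (intro sum_nonneg) auto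
      then show ?thesis unfolding C'_def by linarith
    qed
    finally show ?thesis by simp
  qed
  then show "\<exists>e>0. \<exists>C. \<forall>k. \<forall>y\<in>ball x e \<inter> D. hs k y \<le> ereal C" using s by blast
qed

definition L :: "'a \<Rightarrow> ereal" where "L x = limsup (\<lambda>k. hs k x)"

lemma L_le_usc_reg:
  assumes "x \<in> D" shows "L x \<le> usc_reg D L x"
  unfolding usc_reg_def
proof (rule INF_greatest)
  fix e :: real assume "e \<in> {0<..}"
  then have "x \<in> ball x e \<inter> D" using assms by simp
  then show "L x \<le> (SUP y\<in>ball x e \<inter> D. L y)" by (rule SUP_upper)
qed

text \<open>Averaging over a ball about \<open>y\<close> and discarding, at the cost of the upper bound for
  \<open>hs n\<close>, everything outside a slightly smaller ball about \<open>x\<close> makes the estimate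
  uniform in \<open>y\<close> near \<open>x\<close>; so it survives the regularization.\<close>
lemma usc_reg_le:
  assumes x: "x \<in> D" and h2x: "h2 x \<noteq> -\<infinity>"
  shows "usc_reg D L x \<le> ereal (g x) + h1 x - h2 x"
proof (rule ccontr)
  assume "\<not> ?thesis"
  then obtain t where t: "ereal (g x) + h1 x - h2 x < ereal t" "ereal t < usc_reg D L x"
    using ereal_dense2 by (metis not_le)
  have "h2 x < \<infinity>" using h2 x sbhD(2) unfolding proper_sbh_def by blast
  then obtain b2 where b2: "h2 x = ereal b2" using h2x by (cases "h2 x") auto
  \<comment> \<open>Near \<open>x\<close> the function \<open>g + h1\<close> stays below
    \<open>c0\<close>; subtracting the value \<open>b2\<close> of \<open>h2\<close> at
    \<open>x\<close> brings back \<open>t\<close>.\<close>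
  define c0 where "c0 = t + b2"
  have "ereal (g x) + h1 x < ereal c0" using t(1) b2 by (cases "h1 x") (auto simp: c0_def)
  moreover have "usc_on D h1" using h1 sbhD(1) unfolding proper_sbh_def by blast
  ultimately obtain e1 where e1: "0 < e1" "cball x e1 \<subseteq> D"
      "\<And>y. y \<in> cball x e1 \<Longrightarrow> ereal (g y) + h1 y < ereal c0"
    using usc_add_continuous_less[OF D_open g _ x] by blast
  obtain e2 Mb' where e2: "0 < e2" "\<forall>k. \<forall>y\<in>ball x e2 \<inter> D. hs k y \<le> ereal Mb'"
    using hs_loc_bdd x unfolding loc_unif_bdd_above_def by blast
  \<comment> \<open>Made nonnegative so that it also bounds \<open>rval\<close>, which is 0 where
    \<open>hs n\<close> is minus infinity.\<close>
  define Mb where "Mb = \<bar>Mb'\<bar>"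
  have Mb0: "0 \<le> Mb" by (simp add: Mb_def)
  define R where "R = min e1 (e2 / 2)"
  have R: "0 < R" "cball x R \<subseteq> cball x e1" "cball x R \<subseteq> ball x e2"
    using e1(1) e2(1) by (auto simp: R_def)
  have RD: "cball x R \<subseteq> D" using R(2) e1(2) by blast
  have Mb: "hs k y \<le> ereal Mb" if "y \<in> cball x R" for k y
  proof -
    have "hs k y \<le> ereal Mb'" using e2(2) that R(3) RD by blast
    also have "ereal Mb' \<le> ereal Mb" by (simp add: Mb_def)
    finally show ?thesis .
  qed
  define s where "s = R / 2"
  have s: "0 < s" using R by (simp add: s_def)
  obtain N1 where N1: "\<forall>n\<ge>N1. cball x R \<subseteq> K n" using K_exh[OF compact_cball RD] by blast
  obtain N2 :: nat where N2: "- c0 \<le> real N2" using real_arch_simple by blast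
  have est: "usc_reg D L x \<le> ereal (Mb + (1 - \<delta>) ^ DIM('a) * (t - Mb))" if \<delta>: "0 < \<delta>" "\<delta> < 1" for \<delta>
  proof -
    \<comment> \<open>The radius makes this ball fit into \<open>cball y s\<close> for every
      \<open>y\<close> within \<open>\<delta> * s\<close> of \<open>x\<close>. Its centre remains
      \<open>x\<close>, because the mean of \<open>h2\<close> has to be bounded below by the finite
      value \<open>b2\<close> that \<open>h2\<close> takes there.\<close>
    let ?A = "cball x ((1 - \<delta>) * s)"
    define V where "V = unit_ball_vol (real DIM('a)) * s ^ DIM('a)"
    have V: "measure lborel (cball y s) = V" for y :: 'a
      unfolding V_def using s by (intro measure_cball_eq) simp
    have V0: "0 < V" using V measure_cball_pos[OF s] by metis
    have A0: "0 < (1 - \<delta>) * s" using \<delta> s by simp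
    have VA: "measure lborel ?A = (1 - \<delta>) ^ DIM('a) * V"
      using A0 by (subst measure_cball_eq) (auto simp: V_def power_mult_distrib)
    have "(1 - \<delta>) * s \<le> R" using \<delta> s mult_left_le_one_le[of s "1 - \<delta>"] by (simp add: s_def)
    then have AR: "?A \<subseteq> cball x R" by auto
    then have AD: "?A \<subseteq> D" using RD by blast
    have point: "hs n y \<le> ereal (Mb + (1 - \<delta>) ^ DIM('a) * (t - Mb) + (1 / real (Suc n)) / V)"
      if y: "y \<in> ball x (\<delta> * s)" and n: "N1 \<le> n" "N2 \<le> n" for n y
    proof -
      have d1: "dist x y < \<delta> * s" using y by simp
      have "\<delta> * s \<le> s" using \<delta> s mult_left_le_one_le[of s \<delta>] by simp
      then have yR: "cball y s \<subseteq> cball x R"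
        using d1 by (simp add: cball_subset_cball_iff s_def dist_commute)
      have Ay: "?A \<subseteq> cball y s"
        using d1 by (simp add: cball_subset_cball_iff algebra_simps)
      let ?v = "rval D (hs n)"
      have iA: "set_integrable lborel ?A ?v" and iy: "set_integrable lborel (cball y s) ?v"
        using proper_sbh_on_compact(1)[OF DD hs(2) compact_cball] AD yR RD by blast+
      have "(LINT z:cball y s|lborel. ?v z - Mb) \<le> (LINT z:?A|lborel. ?v z - Mb)"
        unfolding set_lebesgue_integral_def
      proof (rule integral_mono)
        show "integrable lborel (\<lambda>z. indicator (cball y s) z *\<^sub>R (?v z - Mb))"
          using set_integral_diff(1)[OF iy set_integral_const_compact(1)[OF compact_cball]]
          unfolding set_integrable_def .
        show "integrable lborel (\<lambda>z. indicator ?A z *\<^sub>R (?v z - Mb))"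
          using set_integral_diff(1)[OF iA set_integral_const_compact(1)[OF compact_cball]]
          unfolding set_integrable_def .
        fix z
        have "?v z \<le> Mb" if "z \<in> cball y s" using Mb Mb0 yR that by (intro rval_le) auto
        then show "indicator (cball y s) z *\<^sub>R (?v z - Mb) \<le> indicator ?A z *\<^sub>R (?v z - Mb)"
          using Ay by (auto simp: indicator_def simp del: mem_cball)
      qed
      then have 1: "(LINT z:cball y s|lborel. ?v z) - Mb * V
          \<le> (LINT z:?A|lborel. ?v z) - Mb * measure lborel ?A"
        unfolding set_integral_diff(2)[OF iy set_integral_const_compact(1)[OF compact_cball]]
          set_integral_diff(2)[OF iA set_integral_const_compact(1)[OF compact_cball]]
          set_integral_const_compact(2)[OF compact_cball] V .
      have 2: "(LINT z:?A|lborel. ?v z) \<le> c0 * measure lborel ?A - (LINT z:?A|lborel. rval D h2 z) + 1 / real (Suc n)"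
      proof (rule integral_hs_le[OF compact_cball AD])
        show "?A \<subseteq> K n" using AR N1 n by blast
        show "ereal (g z) + h1 z \<le> ereal c0" if "z \<in> ?A" for z
          using e1(3) AR R(2) that by (meson less_imp_le subsetD)
        show "- real n \<le> c0" using N2 n(2) by linarith
      qed
      have 3: "measure lborel ?A * b2 \<le> (LINT z:?A|lborel. rval D h2 z)"
        by (rule proper_sbh_mean_real[OF DD h2 A0 AD b2])
      have "(LINT z:cball y s|lborel. ?v z) \<le> Mb * V + (t - Mb) * measure lborel ?A + 1 / real (Suc n)"
        using 1 2 3 unfolding c0_def by (simp add: algebra_simps)
      also have "\<dots> = V * (Mb + (1 - \<delta>) ^ DIM('a) * (t - Mb) + (1 / real (Suc n)) / V)"
      proof -
        have "V * ((1 / real (Suc n)) / V) = 1 / real (Suc n)" using V0 by simp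
        then show ?thesis unfolding VA distrib_left by (simp add: algebra_simps)
      qed
      finally show ?thesis using yR RD by (intro hs_le_mean[OF s]) (auto simp: V)
    qed
    have Ly: "L y \<le> ereal (Mb + (1 - \<delta>) ^ DIM('a) * (t - Mb))" if y: "y \<in> ball x (\<delta> * s)" for y
    proof -
      let ?a = "Mb + (1 - \<delta>) ^ DIM('a) * (t - Mb)"
      have "(\<lambda>n. ?a + (1 / real (Suc n)) / V) \<longlonglongrightarrow> ?a + 0 / V"
        by (intro tendsto_intros LIMSEQ_Suc[OF lim_1_over_n]) (use V0 in auto)
      then have "(\<lambda>n. ereal (?a + (1 / real (Suc n)) / V)) \<longlonglongrightarrow> ereal ?a" by simp
      then have lim: "limsup (\<lambda>n. ereal (?a + (1 / real (Suc n)) / V)) = ereal ?a"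
        by (intro lim_imp_Limsup) auto
      have "L y \<le> limsup (\<lambda>n. ereal (?a + (1 / real (Suc n)) / V))"
        unfolding L_def
      proof (rule Limsup_mono)
        show "\<forall>\<^sub>F n in sequentially. hs n y \<le> ereal (?a + (1 / real (Suc n)) / V)"
          using point[OF y] by (intro eventually_sequentiallyI[of "max N1 N2"]) auto
      qed
      then show ?thesis using lim by simp
    qed
    have "usc_reg D L x \<le> (SUP y\<in>ball x (\<delta> * s) \<inter> D. L y)"
      unfolding usc_reg_def using \<delta> s by (intro INF_lower) simp
    also have "\<dots> \<le> ereal (Mb + (1 - \<delta>) ^ DIM('a) * (t - Mb))"
      by (rule SUP_least) (use Ly in blast)
    finally show ?thesis .
  qed
  \<comment> \<open>The discarded shell has relative volume tending to 0 with
    \<open>\<delta>\<close>, so the contribution of \<open>Mb\<close> cancels and the bound tends to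
    \<open>t\<close>.\<close>
  have "((\<lambda>\<delta>. Mb + (1 - \<delta>) ^ DIM('a) * (t - Mb)) \<longlongrightarrow> Mb + (1 - 0) ^ DIM('a) * (t - Mb)) (at_right 0)"
    by (intro tendsto_intros)
  then have lim: "((\<lambda>\<delta>. ereal (Mb + (1 - \<delta>) ^ DIM('a) * (t - Mb))) \<longlongrightarrow> ereal t) (at_right 0)"
    by simp
  have "usc_reg D L x \<le> ereal t"
  proof (rule tendsto_lowerbound[OF lim _ trivial_limit_at_right_real])
    show "\<forall>\<^sub>F \<delta> in at_right 0. usc_reg D L x \<le> ereal (Mb + (1 - \<delta>) ^ DIM('a) * (t - Mb))"
      using est by (intro eventually_at_rightI[of 0 1]) auto
  qed
  then show False using t(2) by simp
qed


text \<open>Regularizing can only raise the upper limit, which helps the integral over the ball;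
  that it does not rise above the majorant is the content of \<open>usc_reg_le\<close>.\<close>

lemma usc_reg_minorant:
  assumes h: "h \<in> H" "\<forall>x\<in>D. h x = usc_reg D L x"
  shows "proper_sbh D h" and "AE x in lborel. x \<in> D \<longrightarrow> h x \<le> ereal (g x) + h1 x - h2 x"
    and "ereal c \<le> eint lebesgue (cball x0 r) h"
proof -
  let ?B = "cball x0 r"
  let ?M = "lborel_in ?B"
  have Bb: "?B \<in> sets borel" by simp
  show "AE x in lborel. x \<in> D \<longrightarrow> h x \<le> ereal (g x) + h1 x - h2 x"
    using proper_sbh_AE[OF DD h2]
  proof eventually_elim
    case (elim x)
    show ?case
    proof
      assume x: "x \<in> D"
      then have "h2 x \<noteq> -\<infinity>" using elim by auto
      then show "h x \<le> ereal (g x) + h1 x - h2 x" using usc_reg_le x h(2) by simp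
    qed
  qed
  have sh: "sbh D h" using H_sbh h(1) by blast
  obtain M1 where M1: "0 \<le> M1" "\<forall>k. \<forall>x\<in>?B. hs k x \<le> ereal M1"
    by (rule loc_unif_bdd_above_compact[OF hs_loc_bdd compact_cball ball_sub])
  obtain M2 where M2: "0 \<le> M2" "\<And>x. x \<in> ?B \<Longrightarrow> h x \<le> ereal M2"
    by (rule usc_on_bounded_compact[OF D_open sbhD(1,2)[OF sh] compact_cball ball_sub]) (rule that)
  define V where "V = measure lborel ?B"
  have V0: "0 < V" unfolding V_def by (rule measure_cball_pos[OF r_pos])
  \<comment> \<open>\<open>M1\<close> dominates all \<open>hs k\<close> and \<open>M2\<close>
    dominates \<open>h\<close> on the ball, so the integrands below are nonnegative. The last
    summand ensures \<open>c \<le> M * V\<close>, without which \<open>ennreal (M * V - c)\<close>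
    would be cut off at 0 and the final comparison lost.\<close>
  define M where "M = M1 + M2 + \<bar>c\<bar> / V"
  have M0: "0 \<le> M" "M1 \<le> M" "M2 \<le> M" using M1 M2 V0 by (auto simp: M_def)
  have cM: "c \<le> M * V"
  proof -
    have "c \<le> \<bar>c\<bar> / V * V" using V0 by simp
    also have "\<dots> \<le> M * V" using M1 M2 V0 by (intro mult_right_mono) (auto simp: M_def)
    finally show ?thesis .
  qed
  have meas: "rval D u \<in> borel_measurable borel" if "proper_sbh D u" for u
    using rval_measurable[OF D_open] sbhD(1,2) that unfolding proper_sbh_def by blast
  have nn: "(\<integral>\<^sup>+x. ennreal (M - rval D u x) \<partial>?M) = ennreal (M * V - (LINT x:?B|lborel. rval D u x))"
    if u: "proper_sbh D u" and le: "\<forall>x\<in>?B. u x \<le> ereal M" for u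
  proof -
    have iu: "integrable ?M (rval D u)"
      using integrable_lborel_in(1)[OF Bb meas[OF u]] proper_sbh_on_compact(1)[OF DD u compact_cball ball_sub]
      by blast
    interpret fm: finite_measure ?M by (rule finite_measure_lborel_in[OF compact_cball])
    have ic: "integrable ?M (\<lambda>x. M)" by simp
    have "(\<integral>\<^sup>+x. ennreal (M - rval D u x) \<partial>?M) = ennreal (\<integral>x. M - rval D u x \<partial>?M)"
    proof (rule nn_integral_eq_integral)
      show "integrable ?M (\<lambda>x. M - rval D u x)" using iu ic by simp
      show "AE x in ?M. 0 \<le> M - rval D u x"
        unfolding AE_lborel_in[OF Bb] using rval_le[OF _ M0(1), of u] le by (intro AE_I2) auto
    qed
    also have "(\<integral>x. M - rval D u x \<partial>?M) = (\<integral>x. M \<partial>?M) - (\<integral>x. rval D u x \<partial>?M)"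
      using iu ic by (rule Bochner_Integration.integral_diff[rotated])
    also have "(\<integral>x. M \<partial>?M) = M * V"
      using integrable_lborel_in(2)[OF Bb, of "\<lambda>_. M"] set_integral_const_compact(2)[OF compact_cball[of x0 r], of M]
      unfolding V_def by simp
    also have "(\<integral>x. rval D u x \<partial>?M) = (LINT x:?B|lborel. rval D u x)"
      by (rule integrable_lborel_in(2)[OF Bb meas[OF u]])
    finally show ?thesis .
  qed
  have pointwise: "AE x in ?M. e2ennreal (ereal M - h x) \<le> liminf (\<lambda>k. ennreal (M - rval D (hs k) x))"
  proof -
    have "AE x in lborel. \<forall>k. x \<in> D \<longrightarrow> hs k x = ereal (rval D (hs k) x)"
      unfolding AE_all_countable using proper_sbh_AE[OF DD hs(2)] by blast
    then show ?thesis
      unfolding AE_lborel_in[OF Bb]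
    proof eventually_elim
      case (elim x)
      show ?case
      proof
        assume x: "x \<in> ?B"
        then have xD: "x \<in> D" using ball_sub by blast
        show "e2ennreal (ereal M - h x) \<le> liminf (\<lambda>k. ennreal (M - rval D (hs k) x))"
          unfolding le_Liminf_iff
        proof (intro allI impI)
          fix y assume y: "y < e2ennreal (ereal M - h x)"
          then obtain a where a: "0 \<le> a" "y = ennreal a" by (cases y) auto
          have "ereal a < ereal M - h x"
          proof (rule ccontr)
            assume "\<not> ereal a < ereal M - h x"
            then have "e2ennreal (ereal M - h x) \<le> e2ennreal (ereal a)" by (intro e2ennreal_mono) simp
            then show False using y a by simp
          qed
          then have "h x < ereal (M - a)" using M2(2)[OF x] by (cases "h x") auto
          then have "limsup (\<lambda>k. hs k x) < ereal (M - a)"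
            using L_le_usc_reg[OF xD] h(2) xD unfolding L_def by (metis le_less_trans)
          then have "\<forall>\<^sub>F k in sequentially. hs k x < ereal (M - a)" by (rule Limsup_lessD)
          then show "\<forall>\<^sub>F k in sequentially. y < ennreal (M - rval D (hs k) x)"
          proof eventually_elim
            case (elim k)
            then have "a < M - rval D (hs k) x"
              using \<open>\<forall>k. x \<in> D \<longrightarrow> hs k x = ereal (rval D (hs k) x)\<close> xD by auto
            then show ?case using a by (simp add: ennreal_less_iff)
          qed
        qed
      qed
    qed
  qed
  \<comment> \<open>Fatou's lemma for \<open>M - hs k\<close>: an upper limit of integrals of
    \<open>hs k\<close> is controlled by the integral of the upper limit, which \<open>h\<close>
    dominates.\<close>
  have "(\<integral>\<^sup>+x. e2ennreal (ereal M - h x) \<partial>?M)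
      \<le> (\<integral>\<^sup>+x. liminf (\<lambda>k. ennreal (M - rval D (hs k) x)) \<partial>?M)"
    by (rule nn_integral_mono_AE[OF pointwise])
  also have "\<dots> \<le> liminf (\<lambda>k. \<integral>\<^sup>+x. ennreal (M - rval D (hs k) x) \<partial>?M)"
    using meas[OF hs(2)] by (intro nn_integral_liminf) measurable
  also have "\<dots> \<le> liminf (\<lambda>k. ennreal (M * V - c + 1 / real (Suc k)))"
  proof (rule Liminf_mono, rule always_eventually, rule allI)
    fix k
    have "\<forall>x\<in>?B. hs k x \<le> ereal M" using M1(2) M0(2) by (meson ereal_less_eq(3) order_trans)
    note eq = nn[OF hs(2) this]
    show "(\<integral>\<^sup>+x. ennreal (M - rval D (hs k) x) \<partial>?M) \<le> ennreal (M * V - c + 1 / real (Suc k))"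
      unfolding eq using hs_mass[of k] by (intro ennreal_leI) linarith
  qed
  also have "\<dots> = ennreal (M * V - c)"
  proof (rule lim_imp_Liminf)
    have "(\<lambda>k. M * V - c + 1 / real (Suc k)) \<longlonglongrightarrow> M * V - c + 0"
      by (intro tendsto_intros LIMSEQ_Suc[OF lim_1_over_n])
    then show "(\<lambda>k. ennreal (M * V - c + 1 / real (Suc k))) \<longlonglongrightarrow> ennreal (M * V - c)"
      by (intro tendsto_ennrealI) simp
  qed simp
  finally have fatou: "(\<integral>\<^sup>+x. e2ennreal (ereal M - h x) \<partial>?M) \<le> ennreal (M * V - c)" .
  \<comment> \<open>Were \<open>h\<close> minus infinity throughout \<open>D\<close>, the integral
    in \<open>fatou\<close> would be infinite; the lower bounds on the integrals of
    \<open>hs k\<close> exclude this.\<close>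
  show proper: "proper_sbh D h"
  proof (rule properI[OF h(1)], rule ccontr)
    assume "\<not> (\<exists>x\<in>D. h x \<noteq> -\<infinity>)"
    then have "\<forall>x\<in>?B. h x = -\<infinity>" using ball_sub by blast
    then have "(\<integral>\<^sup>+x. \<infinity> \<partial>?M) \<le> (\<integral>\<^sup>+x. e2ennreal (ereal M - h x) \<partial>?M)"
      by (intro nn_integral_mono_AE) (auto simp: AE_lborel_in[OF Bb])
    then have "(\<integral>\<^sup>+(x::'a). \<infinity> \<partial>?M) < \<infinity>" using fatou by (simp add: le_less_trans)
    moreover have "emeasure ?M (space ?M) \<noteq> 0"
      using V0 unfolding emeasure_space_lborel_in[OF Bb] V_def measure_def by auto
    ultimately show False by (simp add: ennreal_top_mult)
  qed
  have "\<forall>x\<in>?B. h x \<le> ereal M" using M2(2) M0(3) by (meson ereal_less_eq(3) order_trans)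
  then have "ennreal (M * V - (LINT x:?B|lborel. rval D h x)) = (\<integral>\<^sup>+x. ennreal (M - rval D h x) \<partial>?M)"
    using nn[OF proper] by simp
  also have "\<dots> = (\<integral>\<^sup>+x. e2ennreal (ereal M - h x) \<partial>?M)"
  proof (rule nn_integral_cong_AE)
    show "AE x in ?M. ennreal (M - rval D h x) = e2ennreal (ereal M - h x)"
      unfolding AE_lborel_in[OF Bb] using proper_sbh_AE[OF DD proper]
    proof eventually_elim
      case (elim x)
      show ?case
      proof
        assume "x \<in> ?B"
        then have "h x = ereal (rval D h x)" using elim ball_sub by blast
        then show "ennreal (M - rval D h x) = e2ennreal (ereal M - h x)"
          by (metis ereal_minus(1) e2ennreal_ereal)
      qed
    qed
  qed
  finally have "ennreal (M * V - (LINT x:?B|lborel. rval D h x)) \<le> ennreal (M * V - c)"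
    using fatou by simp
  then have "M * V - (LINT x:?B|lborel. rval D h x) \<le> M * V - c"
    using cM by (simp add: ennreal_le_iff)
  then show "ereal c \<le> eint lebesgue ?B h"
    using proper_sbh_eint[OF DD proper compact_cball ball_sub] by simp
qed

end

section \<open>Existence of minorants and the duality\<close>

lemma (in sbh_cone) minorant_exists:
  assumes h1: "h1 \<in> H" "proper_sbh D h1" and h2: "h2 \<in> H" "proper_sbh D h2"
    and g: "continuous_on D g"
    and c: "\<And>\<mu>. \<mu> \<in> JH D H x0 r \<Longrightarrow>
      ereal c \<le> eint \<mu> D (\<lambda>x. ereal (g x)) + eint \<mu> D h1 - eint \<mu> D h2"
  obtains h where "h \<in> H" "proper_sbh D h"
    "AE x in lborel. x \<in> D \<longrightarrow> h x \<le> ereal (g x) + h1 x - h2 x"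
    "ereal c \<le> eint lebesgue (cball x0 r) h"
proof -
  obtain K' :: "nat \<Rightarrow> 'a set" where K': "\<And>n. compact (K' n)" "\<And>n. K' n \<subseteq> D"
    "\<And>A. compact A \<Longrightarrow> A \<subseteq> D \<Longrightarrow> \<exists>N. \<forall>n\<ge>N. A \<subseteq> K' n"
    using open_Union_compact_subsets[OF D_open] by metis
  \<comment> \<open>Adding the ball to every compact set keeps the exhaustion property and lets the
    integral over the ball be formed at each stage.\<close>
  define K where "K = (\<lambda>n. K' n \<union> cball x0 r)"
  have K: "compact (K n)" "K n \<subseteq> D" "cball x0 r \<subseteq> K n" for n
    using K'(1,2) ball_sub by (auto simp: K_def compact_Un simp del: mem_cball)
  have K_exh: "\<exists>N. \<forall>n\<ge>N. A \<subseteq> K n" if "compact A" "A \<subseteq> D" for A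
    using K'(3)[OF that] unfolding K_def by blast
  \<comment> \<open>A single index governs the compact set, the truncation level and the tolerance.
    Since all errors vanish in the limit, the bound \<open>c\<close> is reached exactly.\<close>
  define U where "U = (\<lambda>n h x. max 0 (rval D h x + rval D h2 x
          - max ((if x \<in> D then g x else 0) + rval D h1 x) (- real n)))"
  have "\<exists>h. h \<in> H \<and> proper_sbh D h \<and> c - 1 / real (Suc n) \<le> (LINT x:cball x0 r|lborel. rval D h x)
      \<and> set_integrable lborel (K n) (U n h) \<and> (LINT x:K n|lborel. U n h x) \<le> 1 / real (Suc n)" for n
  proof -
    have e: "0 < 1 / real (Suc n)" by simp
    obtain h where "h \<in> H" "proper_sbh D h" "c - 1 / real (Suc n) \<le> (LINT x:cball x0 r|lborel. rval D h x)"
      "set_integrable lborel (K n) (U n h)" "(LINT x:K n|lborel. U n h x) \<le> 1 / real (Suc n)"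
      unfolding U_def by (rule approximate_minorant[OF h1 h2 g c K[of n] e, where m = n])
    then show ?thesis by blast
  qed
  then obtain hs where hs: "\<And>n. hs n \<in> H" "\<And>n. proper_sbh D (hs n)"
    "\<And>n. c - 1 / real (Suc n) \<le> (LINT x:cball x0 r|lborel. rval D (hs n) x)"
    "\<And>n. set_integrable lborel (K n) (U n (hs n))"
    "\<And>n. (LINT x:K n|lborel. U n (hs n) x) \<le> 1 / real (Suc n)"
    by metis
  interpret minorant_sequence D H x0 r g h1 h2 c K hs
    by unfold_locales (fact g h1(2) h2(2) K(1,2) K_exh hs[unfolded U_def])+
  have "memD D (usc_reg D (\<lambda>x. limsup (\<lambda>k. hs k x))) H"
    using H_limsup hs(1) hs_loc_bdd by blast
  then obtain h where "h \<in> H" "\<forall>x\<in>D. h x = usc_reg D L x"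
    unfolding memD_def L_def by blast
  then show ?thesis using usc_reg_minorant that by blast
qed

theorem theorem1:
  fixes D :: "'a::euclidean_space set" and x0 :: 'a and r :: real
    and H :: "('a \<Rightarrow> ereal) set"
    and g :: "'a \<Rightarrow> real" and h1 h2 f :: "'a \<Rightarrow> ereal"
  assumes D_open: "open D" and D_conn: "connected D" and D_ne: "D \<noteq> {}"
    and o_in: "x0 \<in> D" and r_pos: "r > 0" and ball_sub: "cball x0 r \<subseteq> D"
    and H_sbh: "\<forall>h\<in>H. sbh D h"
    and H_add: "\<forall>u\<in>H. \<forall>v\<in>H. memD D (\<lambda>x. u x + v x) H"
    and H_smult: "\<forall>u\<in>H. \<forall>c::real. c \<ge> 0 \<longrightarrow> memD D (\<lambda>x. ereal c * u x) H"
    and H_0: "memD D (\<lambda>x. 0) H" and H_m1: "memD D (\<lambda>x. -1) H"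
    and H_limsup: "\<forall>hs. (\<forall>k. hs k \<in> H) \<longrightarrow> loc_unif_bdd_above D hs \<longrightarrow>
                      memD D (usc_reg D (\<lambda>x. limsup (\<lambda>k. hs k x))) H"
    and g_cont: "continuous_on D g"
    and h1_H: "h1 \<in> H" and h2_H: "h2 \<in> H"
    and h1_nt: "\<exists>x\<in>D. h1 x \<noteq> -\<infinity>" and h2_nt: "\<exists>x\<in>D. h2 x \<noteq> -\<infinity>"
    and f_ae: "AE x in lebesgue. x \<in> D \<longrightarrow> f x = ereal (g x) + h1 x - h2 x"
  shows "(SUP h\<in>{h\<in>H. (\<exists>x\<in>D. h x \<noteq> -\<infinity>) \<and> (AE x in lebesgue. x \<in> D \<longrightarrow> h x \<le> f x)}.
            eint lebesgue (cball x0 r) h)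
         = (INF \<mu>\<in>JH D H x0 r.
              eint \<mu> D (\<lambda>x. ereal (g x)) + eint \<mu> D h1 - eint \<mu> D h2)
    \<and> ((\<exists>h\<in>H. (\<exists>x\<in>D. h x \<noteq> -\<infinity>) \<and> (AE x in lebesgue. x \<in> D \<longrightarrow> h x \<le> f x))
       \<longleftrightarrow> (INF \<mu>\<in>JH D H x0 r.
              eint \<mu> D (\<lambda>x. ereal (g x)) + eint \<mu> D h1 - eint \<mu> D h2) \<noteq> -\<infinity>)"
proof -
  interpret sbh_cone D H x0 r
    using assms by unfold_locales
  define S where "S = {h\<in>H. (\<exists>x\<in>D. h x \<noteq> -\<infinity>) \<and> (AE x in lebesgue. x \<in> D \<longrightarrow> h x \<le> f x)}"
  define Y where "Y = (INF \<mu>\<in>JH D H x0 r. eint \<mu> D (\<lambda>x. ereal (g x)) + eint \<mu> D h1 - eint \<mu> D h2)"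
  note h1 = h1_H properI[OF h1_H h1_nt] and h2 = h2_H properI[OF h2_H h2_nt]
  have f_ae': "AE x in lborel. x \<in> D \<longrightarrow> f x = ereal (g x) + h1 x - h2 x"
    using f_ae by (simp add: AE_completion_iff)
  have S_iff: "h \<in> S \<longleftrightarrow> h \<in> H \<and> proper_sbh D h \<and>
      (AE x in lborel. x \<in> D \<longrightarrow> h x \<le> ereal (g x) + h1 x - h2 x)" for h
  proof -
    have "(AE x in lebesgue. x \<in> D \<longrightarrow> h x \<le> f x) \<longleftrightarrow>
        (AE x in lborel. x \<in> D \<longrightarrow> h x \<le> ereal (g x) + h1 x - h2 x)"
      unfolding AE_completion_iff
      by (rule eventually_subst) (use f_ae' in \<open>eventually_elim, auto\<close>)
    then show ?thesis using H_sbh unfolding S_def proper_sbh_def by blast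
  qed
  have upper: "eint lebesgue (cball x0 r) h \<le> Y" if "h \<in> S" for h
    unfolding Y_def using that minorant_le_dual[OF _ _ h1 h2 g_cont] S_iff by (intro INF_greatest) blast
  have fin: "-\<infinity> < eint lebesgue (cball x0 r) h" if "h \<in> S" for h
    using that proper_sbh_eint[OF D_open D_conn _ compact_cball ball_sub] S_iff by auto
  \<comment> \<open>Working with real \<open>c\<close> below \<open>Y\<close> spares a distinction
    by the finiteness of \<open>Y\<close>. The same statement yields the inequality by density of
    the reals and the existence criterion from any one such \<open>c\<close>.\<close>
  have exists: "\<exists>h\<in>S. ereal c \<le> eint lebesgue (cball x0 r) h" if "ereal c \<le> Y" for c
  proof -
    have c: "ereal c \<le> eint \<mu> D (\<lambda>x. ereal (g x)) + eint \<mu> D h1 - eint \<mu> D h2"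
      if "\<mu> \<in> JH D H x0 r" for \<mu>
      using \<open>ereal c \<le> Y\<close> INF_lower[OF that] unfolding Y_def by (rule order_trans)
    obtain h where "h \<in> H" "proper_sbh D h"
      "AE x in lborel. x \<in> D \<longrightarrow> h x \<le> ereal (g x) + h1 x - h2 x"
      "ereal c \<le> eint lebesgue (cball x0 r) h"
      by (rule minorant_exists[OF h1 h2 g_cont c])
    then show ?thesis using S_iff by blast
  qed
  have "(SUP h\<in>S. eint lebesgue (cball x0 r) h) = Y"
  proof (rule antisym)
    show "(SUP h\<in>S. eint lebesgue (cball x0 r) h) \<le> Y" by (rule SUP_least) (rule upper)
    show "Y \<le> (SUP h\<in>S. eint lebesgue (cball x0 r) h)"
    proof (rule ccontr)
      assume "\<not> ?thesis"
      then obtain c where c: "(SUP h\<in>S. eint lebesgue (cball x0 r) h) < ereal c" "ereal c < Y"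
        using ereal_dense2 by (metis not_le)
      then obtain h where "h \<in> S" "ereal c \<le> eint lebesgue (cball x0 r) h"
        using exists by (meson less_imp_le)
      then have "ereal c \<le> (SUP h\<in>S. eint lebesgue (cball x0 r) h)" by (intro SUP_upper2)
      then show False using c(1) by simp
    qed
  qed
  moreover have "(\<exists>h. h \<in> S) \<longleftrightarrow> Y \<noteq> -\<infinity>"
  proof
    assume "\<exists>h. h \<in> S"
    then show "Y \<noteq> -\<infinity>" using upper fin by fastforce
  next
    assume "Y \<noteq> -\<infinity>"
    then obtain c where "ereal c \<le> Y" by (metis ereal_bot linear)
    then show "\<exists>h. h \<in> S" using exists by blast
  qed
  ultimately show ?thesis unfolding S_def Y_def by blast
qed

end
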